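(* Let $\theta\in(0,1]$ and let $(Z_n)_{n\ge 0}$ be a power-fractional Galton-Watson process with one ancestor in the iid random environment $\mathbf{e}=(\mathbf e_n)_{n\ge 1}=((A_n,B_n))_{n\ge 1}$ with quenched offspring laws $\mathsf{PF}(\theta,A_n,B_n)$, as described in the context. Suppose the process is subcritical, so that $R_\infty^{(-1)}<\infty=R_\infty$ a.s. Then, as $n\to\infty$, $$\Pi_n^{1/\theta}\,\mathbf P(Z_n>0)=\frac{1}{(1+R_n/\Pi_n)^{1/\theta}}\ \xrightarrow{\;d\;}\ \frac{1}{(1+R_\infty^{(-1)})^{1/\theta}},$$ $$\mathbf E(Z_n\,|\,Z_n>0)=(1+R_n/\Pi_n)^{1/\theta}\ \xrightarrow{\;d\;}\ (1+R_\infty^{(-1)})^{1/\theta},$$ where the equalities hold for almost all realizations of $\mathbf e$ and $\xrightarrow{d}$ is convergence in distribution of random variables (functions of $\mathbf e$); and, for almost all realizations of $\mathbf e$, $$\Big\|\mathbf P^{(n:1)}(Z_n\in\cdot\,|\,Z_n>0)-\mathsf{PF}_+\Big(\theta,\frac{1}{1+R_\infty^{(-1)}}\Big)\Big\|\ \to\ 0,$$ where $\|\cdot\|$ denotes total variation.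
   Context: For $\theta\in(0,1]$ and $a,b>0$ with $a+b\ge 1$, $\mathsf{PF}(\theta,a,b)$ is the probability distribution on $\mathbb{N}_0$ with probability generating function $s\mapsto 1-\big[\frac{a}{(1-s)^{\theta}}+b\big]^{-1/\theta}$, $s\in[0,1)$ (value $1$ at $s=1$). For $a\in(0,1)$, $\mathsf{PF}_+(\theta,a):=\mathsf{PF}(\theta,a,1-a)$, a law on $\{1,2,\dots\}$. Setting: $\mathbf e_n=(A_n,B_n)$, $n\ge 1$, are iid random vectors with $\mathbb{P}(A_n>0,\,B_n>0,\,A_n+B_n\ge 1)=1$. Given $\mathbf e$, $(Z_n)_{n\ge 0}$ is a branching process with $Z_0=1$ in which individuals of generation $n-1$ independently produce offspring with law $\mathsf{PF}(\theta,A_n,B_n)$. $\mathbf P=\mathbb{P}(\cdot|\mathbf e)$ with expectation $\mathbf E$. For each $n$, $\mathbf P^{(n:1)}$ denotes the quenched law of $(Z_0,\dots,Z_n)$ under the time-reversed environment $(\mathbf e_n,\dots,\mathbf e_1)$, i.e. given $\mathbf e$, individuals of generation $k-1$ have offspring law $\mathsf{PF}(\theta,A_{n-k+1},B_{n-k+1})$ for $k=1,\dots,n$; thus $Z_n$ has generating function $f_n\circ\cdots\circ f_1$ under $\mathbf P^{(n:1)}$, where $f_k$ is the generating function of $\mathsf{PF}(\theta,A_k,B_k)$. Put $\Pi_0=1$, $\Pi_n=\prod_{k=1}^nA_k$, $R_n=\sum_{k=1}^n\Pi_{k-1}B_k$, $R_\infty=\sum_{k\ge 1}\Pi_{k-1}B_k$,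 $R_\infty^{(-1)}=\sum_{k\ge1}\Pi_k^{-1}B_k$. The subcritical hypothesis means here that $R_\infty^{(-1)}<\infty=R_\infty$ a.s. *)

theory Defs
  imports "HOL-Probability.Probability"
begin

(* The law on the naturals with the given generating function.  For \<theta> \<in> (0,1], a, b > 0 and
   a + b \<ge> 1 it exists and is unique; outside this range the term is unspecified. *)
definition PF :: "real \<Rightarrow> real \<Rightarrow> real \<Rightarrow> nat pmf" where
  "PF \<theta> a b = (THE p. \<forall>s\<in>{0..<1::real}.
     (\<Sum>n. pmf p n * s ^ n) = 1 - (a / (1 - s) powr \<theta> + b) powr (- 1 / \<theta>))"

definition PF_plus :: "real \<Rightarrow> real \<Rightarrow> nat pmf" where
  "PF_plus \<theta> a = PF \<theta> a (1 - a)"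

(* Law of (Z 0, ..., Z n), as a list of length n + 1, for a Galton-Watson process in varying
   environment with one ancestor: individuals of generation k - 1 have offspring law q k.
   Environments are indexed from 1, so q 0 is never used. *)
primrec gw_path :: "(nat \<Rightarrow> nat pmf) \<Rightarrow> nat \<Rightarrow> nat list pmf" where
  "gw_path q 0 = return_pmf [1]"
| "gw_path q (Suc n) = bind_pmf (gw_path q n) (\<lambda>zs.
     map_pmf (\<lambda>xs. zs @ [sum_list xs]) (replicate_pmf (last zs) (q (Suc n))))"

definition quenched_law :: "real \<Rightarrow> (nat \<Rightarrow> real) \<Rightarrow> (nat \<Rightarrow> real) \<Rightarrow> nat \<Rightarrow> nat list pmf" where
  "quenched_law \<theta> a b n = gw_path (\<lambda>k. PF \<theta> (a k) (b k)) n"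

definition reversed_quenched_law ::
    "real \<Rightarrow> (nat \<Rightarrow> real) \<Rightarrow> (nat \<Rightarrow> real) \<Rightarrow> nat \<Rightarrow> nat list pmf" where
  "reversed_quenched_law \<theta> a b n = quenched_law \<theta> (\<lambda>k. a (n + 1 - k)) (\<lambda>k. b (n + 1 - k)) n"

definition env_Pi :: "(nat \<Rightarrow> real) \<Rightarrow> nat \<Rightarrow> real" where
  "env_Pi a n = (\<Prod>k=1..n. a k)"

definition env_R :: "(nat \<Rightarrow> real) \<Rightarrow> (nat \<Rightarrow> real) \<Rightarrow> nat \<Rightarrow> real" where
  "env_R a b n = (\<Sum>k=1..n. env_Pi a (k - 1) * b k)"

(* The two series have positive terms almost surely and may diverge, hence the values in
   ennreal; the summation index is shifted by one. *)
definition env_R_inf :: "(nat \<Rightarrow> real) \<Rightarrow> (nat \<Rightarrow> real) \<Rightarrow> ennreal" where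
  "env_R_inf a b = (\<Sum>k. ennreal (env_Pi a k * b (Suc k)))"

definition env_Rinv_inf :: "(nat \<Rightarrow> real) \<Rightarrow> (nat \<Rightarrow> real) \<Rightarrow> ennreal" where
  "env_Rinv_inf a b = (\<Sum>k. ennreal (b (Suc k) / env_Pi a (Suc k)))"

definition env_algebra ::
    "'w measure \<Rightarrow> (nat \<Rightarrow> 'w \<Rightarrow> real) \<Rightarrow> (nat \<Rightarrow> 'w \<Rightarrow> real) \<Rightarrow> 'w measure" where
  "env_algebra M A B = vimage_algebra (space M) (\<lambda>\<omega>. \<lambda>n\<in>{1..}. (A n \<omega>, B n \<omega>))
     (\<Pi>\<^sub>M n\<in>{1::nat..}. (borel :: (real \<times> real) measure))"

locale pf_gw_process = prob_space M for M :: "'w measure" +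
  fixes \<theta> :: real and A B :: "nat \<Rightarrow> 'w \<Rightarrow> real" and Z :: "nat \<Rightarrow> 'w \<Rightarrow> nat"
  assumes theta: "0 < \<theta>" "\<theta> \<le> 1"
    and env_indep: "indep_vars (\<lambda>_. borel) (\<lambda>n \<omega>. (A n \<omega>, B n \<omega>)) {1..}"
    and env_ident: "\<And>n. n \<ge> 1 \<Longrightarrow>
      distr M borel (\<lambda>\<omega>. (A n \<omega>, B n \<omega>)) = distr M borel (\<lambda>\<omega>. (A 1 \<omega>, B 1 \<omega>))"
    and env_range: "\<And>n. n \<ge> 1 \<Longrightarrow>
      AE \<omega> in M. A n \<omega> > 0 \<and> B n \<omega> > 0 \<and> A n \<omega> + B n \<omega> \<ge> 1"
    and Z_measurable: "\<And>n. Z n \<in> measurable M (count_space UNIV)"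
    and Z_given_env: "\<And>n zs. AE \<omega> in M.
      real_cond_exp M (env_algebra M A B)
        (indicator {\<omega> \<in> space M. map (\<lambda>k. Z k \<omega>) [0..<Suc n] = zs}) \<omega>
      = pmf (quenched_law \<theta> (\<lambda>k. A k \<omega>) (\<lambda>k. B k \<omega>) n) zs"

definition quenched_prob :: "'w measure \<Rightarrow> 'w measure \<Rightarrow> ('w \<Rightarrow> bool) \<Rightarrow> 'w \<Rightarrow> real" where
  "quenched_prob M F E = real_cond_exp M F (indicator {\<omega> \<in> space M. E \<omega>})"

(* Expectation of X \<ge> 0 under the quenched measure conditioned on the event E.  The nonnegative
   conditional expectation is used because the annealed expectation of X may be infinite.
   An infinite value is sent to 0 by enn2real. *)
definition quenched_expectation_given ::
    "'w measure \<Rightarrow> 'w measure \<Rightarrow> ('w \<Rightarrow> real) \<Rightarrow> ('w \<Rightarrow> bool) \<Rightarrow> 'w \<Rightarrow> real" where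
  "quenched_expectation_given M F X E \<omega> =
     enn2real (nn_cond_exp M F (\<lambda>\<omega>. ennreal (X \<omega>) * indicator {\<omega> \<in> space M. E \<omega>} \<omega>) \<omega>)
     / quenched_prob M F E \<omega>"

(* Normalised as a supremum over sets; the norm of the signed measure is twice this. *)
definition tv_dist :: "'a pmf \<Rightarrow> 'a pmf \<Rightarrow> real" where
  "tv_dist p q = (SUP S. \<bar>measure_pmf.prob p S - measure_pmf.prob q S\<bar>)"

end

theory Submission
  imports Defs
begin

text \<open>
  Writing a generating function as \<open>1 - X powr (- 1 / \<theta>)\<close> with \<open>X\<close> affine in \<open>(1 - s) powr (- \<theta>)\<close>,
  composition of power-fractional laws becomes composition of affine maps. Hence \<open>Z n\<close> has the
  generating function of \<open>PF\<close> with parameters \<open>\<Pi>\<^sub>n\<close> and \<open>R\<^sub>n\<close>, which gives the survival probability (at \<open>s = 0\<close>)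
  and the mean (as \<open>s \<rightarrow> 1\<close>). Since the environment is iid, reversing the time shows that
  \<open>R\<^sub>n / \<Pi>\<^sub>n = \<Sum>k\<le>n. B\<^sub>k / (A\<^sub>k \<cdots> A\<^sub>n)\<close> is distributed as the partial sum \<open>\<Sum>k\<le>n. B\<^sub>k / \<Pi>\<^sub>k\<close>, which converges
  almost surely. In the reversed environment the partial sum \<open>S\<close> itself occurs, and conditioning on
  survival normalises the parameters to \<open>1 / (1 + S)\<close> and \<open>S / (1 + S)\<close>; pointwise convergence of the generating
  functions then yields convergence in total variation by Scheffe's lemma.
\<close>

section \<open>Existence of power-fractional laws\<close>

text \<open>
  The derivative of the generating function is \<open>a * w powr (- (1 / \<theta> + 1))\<close> with
  \<open>w = (a + b) * (1 - c * h s)\<close>, \<open>c = b / (a + b)\<close> and \<open>h s = 1 - (1 - s) powr \<theta>\<close>. By the binomial series both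
  \<open>h\<close> and \<open>(1 - x) powr (- \<beta>)\<close> have nonnegative coefficients, hence so does their composition.
\<close>

definition nonneg_powser :: "(real \<Rightarrow> real) \<Rightarrow> bool" where
  "nonneg_powser f \<longleftrightarrow> (\<exists>c::nat \<Rightarrow> real. (\<forall>n. 0 \<le> c n) \<and> (\<forall>s\<in>{0..<1}. (\<lambda>n. c n * s ^ n) sums f s))"

lemma nonneg_powserI:
  assumes "\<And>n. 0 \<le> c n" "\<And>s. 0 \<le> s \<Longrightarrow> s < 1 \<Longrightarrow> (\<lambda>n. c n * s ^ n) sums f s"
  shows "nonneg_powser f"
  unfolding nonneg_powser_def using assms by (intro exI[of _ c]) auto

lemma nonneg_powserE:
  assumes "nonneg_powser f"
  obtains c :: "nat \<Rightarrow> real" where "\<And>n. 0 \<le> c n"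
    "\<And>s. 0 \<le> s \<Longrightarrow> s < 1 \<Longrightarrow> (\<lambda>n. c n * s ^ n) sums f s"
  using assms unfolding nonneg_powser_def by (metis atLeastLessThan_iff)

lemma nonneg_powser_const:
  assumes "0 \<le> a" shows "nonneg_powser (\<lambda>_. a)"
proof (rule nonneg_powserI[where c = "\<lambda>n. if n = 0 then a else 0"])
  fix s :: real
  have "(\<lambda>n. if n = 0 then a else 0) = (\<lambda>n. (if n = 0 then a else 0) * s ^ n)"
    by auto
  then show "(\<lambda>n. (if n = 0 then a else 0) * s ^ n) sums a"
    using sums_single[of 0 "\<lambda>_. a"] by (simp add: if_distrib cong: if_cong)
qed (use assms in auto)

lemma nonneg_powser_mult:
  assumes "nonneg_powser f" "nonneg_powser g"
  shows "nonneg_powser (\<lambda>s. f s * g s)"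
proof -
  obtain c where c: "\<And>n. 0 \<le> c n" "\<And>s. 0 \<le> s \<Longrightarrow> s < 1 \<Longrightarrow> (\<lambda>n. c n * s ^ n) sums f s"
    using assms(1) by (elim nonneg_powserE) blast
  obtain d where d: "\<And>n. 0 \<le> d n" "\<And>s. 0 \<le> s \<Longrightarrow> s < 1 \<Longrightarrow> (\<lambda>n. d n * s ^ n) sums g s"
    using assms(2) by (elim nonneg_powserE) blast
  show ?thesis
  proof (rule nonneg_powserI[where c = "\<lambda>k. \<Sum>i\<le>k. c i * d (k - i)"])
    show "0 \<le> (\<Sum>i\<le>k. c i * d (k - i))" for k
      by (intro sum_nonneg mult_nonneg_nonneg c d)
    fix s :: real assume s: "0 \<le> s" "s < 1"
    have "(\<lambda>k. \<Sum>i\<le>k. (c i * s ^ i) * (d (k - i) * s ^ (k - i))) sums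
        ((\<Sum>k. c k * s ^ k) * (\<Sum>k. d k * s ^ k))"
      by (rule Cauchy_product_sums)
        (use s c d sums_summable[OF c(2)] sums_summable[OF d(2)] in \<open>auto simp: abs_mult\<close>)
    moreover have "(\<Sum>i\<le>k. (c i * s ^ i) * (d (k - i) * s ^ (k - i)))
        = (\<Sum>i\<le>k. c i * d (k - i)) * s ^ k" for k
      unfolding sum_distrib_right
      by (rule sum.cong) (auto simp: power_add[symmetric] algebra_simps)
    ultimately show "(\<lambda>k. (\<Sum>i\<le>k. c i * d (k - i)) * s ^ k) sums (f s * g s)"
      using sums_unique[OF c(2)[OF s]] sums_unique[OF d(2)[OF s]] by simp
  qed
qed

lemma nonneg_powser_power: "nonneg_powser f \<Longrightarrow> nonneg_powser (\<lambda>s. f s ^ k)"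
  by (induction k) (auto intro: nonneg_powser_const nonneg_powser_mult)

text \<open>Tonelli for a double series of nonnegative terms: the coefficients of the sum are the
  sums of the coefficients. It serves to expand one power series composed with another.\<close>

lemma nonneg_powser_sums:
  assumes g: "\<And>k. nonneg_powser (g k)"
    and f: "\<And>s. 0 \<le> s \<Longrightarrow> s < 1 \<Longrightarrow> (\<lambda>k. g k s) sums f s"
  shows "nonneg_powser f"
proof -
  have "\<forall>k. \<exists>c::nat \<Rightarrow> real. (\<forall>n. 0 \<le> c n) \<and> (\<forall>s\<in>{0..<1}. (\<lambda>n. c n * s ^ n) sums g k s)"
    using g unfolding nonneg_powser_def by auto
  then obtain c where "\<forall>k. (\<forall>n. 0 \<le> c k n) \<and> (\<forall>s\<in>{0..<1::real}. (\<lambda>n. c k n * s ^ n) sums g k s)"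
    by metis
  then have c: "\<And>k n. (0::real) \<le> c k n"
    "\<And>k s. 0 \<le> s \<Longrightarrow> s < 1 \<Longrightarrow> (\<lambda>n. c k n * s ^ n) sums g k s" by auto
  have sum_c: "summable (\<lambda>k. c k n)" for n
  proof -
    \<comment> \<open>A single term \<open>c k n * (1/2) ^ n\<close> is at most the whole sum
      \<open>g k (1/2)\<close>, so one interior point bounds the coefficients summably in
      \<open>k\<close>.\<close>
    have "summable (\<lambda>k. g k (1/2) * 2 ^ n)"
      using f[of "1/2"] by (intro summable_mult2) (auto simp: sums_iff)
    moreover have "norm (c k n) \<le> g k (1/2) * 2 ^ n" for k
    proof -
      have "c k n * (1/2) ^ n = (\<Sum>m\<in>{n}. c k m * (1/2) ^ m)" by simp
      also have "\<dots> \<le> g k (1/2)"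
        using c(2)[of "1/2" k] sum_le_suminf[of "\<lambda>m. c k m * (1/2) ^ m" "{n}"] c(1)
        by (auto simp: sums_iff)
      finally show ?thesis using c(1)[of k n] by (simp add: field_simps)
    qed
    ultimately show ?thesis by (rule summable_comparison_test'[where N = 0])
  qed
  show ?thesis
  proof (rule nonneg_powserI[where c = "\<lambda>n. \<Sum>k. c k n"])
    show "0 \<le> (\<Sum>k. c k n)" for n by (intro suminf_nonneg sum_c c)
    fix s :: real assume s: "0 \<le> s" "s < 1"
    have g0: "0 \<le> g k s" for k
      using c(2)[OF s, of k] c(1) s suminf_nonneg[of "\<lambda>n. c k n * s ^ n"] by (auto simp: sums_iff)
    have f0: "0 \<le> f s" using f[OF s] g0 suminf_nonneg[of "\<lambda>k. g k s"] by (auto simp: sums_iff)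
    \<comment> \<open>In \<open>ennreal\<close> the two summations are exchanged without any
      summability condition; finiteness of \<open>f s\<close> then brings the identity back to the
      reals.\<close>
    have "(\<Sum>n. ennreal ((\<Sum>k. c k n) * s ^ n)) = (\<Sum>n. \<Sum>k. ennreal (c k n * s ^ n))"
      using s c sum_c
      by (intro suminf_cong)
        (subst suminf_mult2, auto intro!: suminf_ennreal2[symmetric] summable_mult2)
    also have "\<dots> = (\<integral>\<^sup>+n. (\<Sum>k. ennreal (c k n * s ^ n)) \<partial>count_space UNIV)"
      by (rule nn_integral_count_space_nat[symmetric])
    also have "\<dots> = (\<Sum>k. \<integral>\<^sup>+n. ennreal (c k n * s ^ n) \<partial>count_space UNIV)"
      by (rule nn_integral_suminf) auto
    also have "\<dots> = (\<Sum>k. ennreal (g k s))"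
      unfolding nn_integral_count_space_nat
      using c s by (intro suminf_cong suminf_ennreal_eq c(2)) auto
    also have "\<dots> = ennreal (f s)"
      by (rule suminf_ennreal_eq[OF g0 f[OF s]])
    finally have eq: "(\<Sum>n. ennreal ((\<Sum>k. c k n) * s ^ n)) = ennreal (f s)" .
    have nn: "0 \<le> (\<Sum>k. c k n) * s ^ n" for n
      using s by (intro mult_nonneg_nonneg suminf_nonneg sum_c c) auto
    have "(\<lambda>n. ennreal ((\<Sum>k. c k n) * s ^ n)) sums ennreal (f s)"
      using eq by (simp add: sums_iff)
    then show "(\<lambda>n. (\<Sum>k. c k n) * s ^ n) sums f s"
      using nn f0 by simp
  qed
qed

text \<open>Integrating the series of \<open>g'\<close> term by term, with constant term
  \<open>g 0\<close>, gives a function with the derivative of \<open>g\<close> and its value at 0,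
  hence \<open>g\<close> itself on [0,1).\<close>

lemma nonneg_powser_antideriv:
  assumes g': "nonneg_powser g'" and g0: "0 \<le> g 0"
    and der: "\<And>s. 0 \<le> s \<Longrightarrow> s < 1 \<Longrightarrow> (g has_real_derivative g' s) (at s)"
  shows "nonneg_powser g"
proof -
  obtain d where d: "\<And>n. 0 \<le> d n" "\<And>s. 0 \<le> s \<Longrightarrow> s < 1 \<Longrightarrow> (\<lambda>n. d n * s ^ n) sums g' s"
    using g' by (elim nonneg_powserE) blast
  define e where "e n = (if n = 0 then g 0 else d (n - 1) / real n)" for n
  have e0: "0 \<le> e n" for n using d(1) g0 by (simp add: e_def)
  have summ: "summable (\<lambda>n. e n * s ^ n)" if s: "0 \<le> s" "s < 1" for s
  proof -
    have "summable (\<lambda>n. e (Suc n) * s ^ n)"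
    proof (rule summable_comparison_test'[where N = 0])
      show "summable (\<lambda>n. d n * s ^ n)" using d(2)[OF s] by (simp add: sums_iff)
      show "norm (e (Suc n) * s ^ n) \<le> d n * s ^ n" for n
      proof -
        have "d n / real (Suc n) \<le> d n / 1" by (rule divide_left_mono) (use d(1)[of n] in auto)
        then have "d n / real (Suc n) * s ^ n \<le> d n * s ^ n" using s by (intro mult_right_mono) auto
        then show ?thesis using s d(1)[of n] by (simp add: e_def)
      qed
    qed
    then show ?thesis by (simp add: summable_powser_split_head)
  qed
  define P where "P s = (\<Sum>n. e n * s ^ n)" for s
  have diffs_e: "diffs e n = d n" for n by (simp add: diffs_def e_def)
  have P: "(P has_real_derivative g' s) (at s)" if s: "0 \<le> s" "s < 1" for s
  proof -
    have "(P has_real_derivative (\<Sum>n. diffs e n * s ^ n)) (at s)"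
      unfolding P_def
      \<comment> \<open>The midpoint of \<open>s\<close> and 1 lies beyond \<open>s\<close>, and the
        series still converges there.\<close>
      by (rule termdiffs_strong[where K = "(1 + s) / 2"]) (use s in \<open>auto intro!: summ\<close>)
    then show ?thesis using d(2)[OF s] by (simp add: diffs_e sums_iff)
  qed
  have Pg: "P s = g s" if s: "0 \<le> s" "s < 1" for s
  proof (cases "s = 0")
    case True
    then show ?thesis by (simp add: P_def e_def powser_zero)
  next
    case False
    with s have "0 < s" by simp
    have "(\<lambda>x. P x - g x) s = (\<lambda>x. P x - g x) 0"
    proof (rule DERIV_isconst2[OF \<open>0 < s\<close>])
      show "continuous_on {0..s} (\<lambda>x. P x - g x)"
        using s by (intro continuous_at_imp_continuous_on ballI)
          (auto intro!: continuous_intros DERIV_isCont[OF P] DERIV_isCont[OF der])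
      show "((\<lambda>x. P x - g x) has_real_derivative 0) (at x)" if "0 < x" "x < s" for x
        using DERIV_diff[OF P[of x] der[of x]] that s by simp
    qed (use s in auto)
    then show ?thesis by (simp add: P_def e_def powser_zero)
  qed
  show ?thesis
    by (rule nonneg_powserI[where c = e]) (use e0 summ Pg in \<open>auto simp: P_def sums_iff\<close>)
qed

text \<open>For n > 0 the coefficient is \<open>- pochhammer (- \<theta>) n / fact n\<close>, and
  \<open>pochhammer (- \<theta>) n\<close> is \<open>- \<theta>\<close> times a rising factorial of
  \<open>1 - \<theta>\<close>. The bound \<theta> \<le> 1 makes the latter nonnegative and so fixes
  the sign.\<close>

lemma nonneg_powser_one_minus_powr:
  assumes "0 < \<theta>" "\<theta> \<le> 1"
  shows "nonneg_powser (\<lambda>s. 1 - (1 - s) powr \<theta>)"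
proof (rule nonneg_powserI[where c = "\<lambda>n. if n = 0 then 0 else - (\<theta> gchoose n) * (- 1) ^ n"])
  show "0 \<le> (if n = 0 then 0 else - (\<theta> gchoose n) * (- 1) ^ n)" for n
  proof (cases n)
    case (Suc m)
    have "0 \<le> pochhammer (1 - \<theta>) m"
      using assms by (cases "\<theta> = 1") (auto simp: pochhammer_0_left intro!: pochhammer_nonneg)
    then have "pochhammer (- \<theta>) n \<le> 0"
      using assms Suc by (simp add: pochhammer_rec mult_le_0_iff)
    moreover have "- (\<theta> gchoose n) * (- 1) ^ n = - pochhammer (- \<theta>) n / fact n"
    proof -
      have "(- 1) ^ n * (- 1 :: real) ^ n = 1" by (simp flip: power_mult_distrib)
      then show ?thesis by (simp add: gbinomial_pochhammer)
    qed
    ultimately show ?thesis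
      using Suc by (simp add: divide_nonpos_pos del: power_Suc pochhammer_Suc fact_Suc)
  qed simp
  fix s :: real assume s: "0 \<le> s" "s < 1"
  have "(\<lambda>n. (\<theta> gchoose n) * (- s) ^ n) sums (1 + (- s)) powr \<theta>"
    by (rule gen_binomial_real) (use s in auto)
  from sums_diff[OF sums_single[of 0 "\<lambda>_. 1"] this]
  have "(\<lambda>n. (if n = 0 then 1 else 0) - (\<theta> gchoose n) * (- s) ^ n) sums (1 - (1 - s) powr \<theta>)"
    by simp
  moreover have "(if n = 0 then 1 else 0) - (\<theta> gchoose n) * (- s) ^ n
      = (if n = 0 then 0 else - (\<theta> gchoose n) * (- 1) ^ n) * s ^ n" for n
    using power_mult_distrib[of "-1" s n] by auto
  ultimately show "(\<lambda>n. (if n = 0 then 0 else - (\<theta> gchoose n) * (- 1) ^ n) * s ^ n) sums (1 - (1 - s) powr \<theta>)"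
    by simp
qed

text \<open>The negative binomial series in \<open>c * h s\<close> has the positive coefficients
  \<open>pochhammer \<beta> k / fact k\<close>, and \<open>c * h s < 1\<close> keeps the argument
  inside the disc of convergence.\<close>

lemma nonneg_powser_one_minus_mult_powr:
  assumes h: "nonneg_powser h" "\<And>s. 0 \<le> s \<Longrightarrow> s < 1 \<Longrightarrow> 0 \<le> h s \<and> h s < 1"
    and c: "0 \<le> c" "c < 1" and \<beta>: "0 < \<beta>"
  shows "nonneg_powser (\<lambda>s. (1 - c * h s) powr (- \<beta>))"
proof (rule nonneg_powser_sums[where g = "\<lambda>k s. (pochhammer \<beta> k / fact k * c ^ k) * h s ^ k"])
  show "nonneg_powser (\<lambda>s. (pochhammer \<beta> k / fact k * c ^ k) * h s ^ k)" for k
    using c \<beta> pochhammer_nonneg[OF \<beta>, of k]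
    by (intro nonneg_powser_mult nonneg_powser_const nonneg_powser_power h) auto
  fix s :: real assume s: "0 \<le> s" "s < 1"
  have "c * h s \<le> 1 * h s" using c h(2)[OF s] by (intro mult_right_mono) auto
  with h(2)[OF s] have "c * h s < 1" by auto
  then have "(\<lambda>n. (- \<beta> gchoose n) * (- (c * h s)) ^ n) sums (1 + (- (c * h s))) powr (- \<beta>)"
    using c h(2)[OF s] by (intro gen_binomial_real) auto
  moreover have "(- \<beta> gchoose n) * (- (c * h s)) ^ n = (pochhammer \<beta> n / fact n * c ^ n) * h s ^ n" for n
  proof -
    have "(- 1) ^ n * (- 1 :: real) ^ n = 1" by (simp flip: power_mult_distrib)
    then show ?thesis
      using power_mult_distrib[of "-1" "c * h s" n] by (simp add: gbinomial_pochhammer power_mult_distrib)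
  qed
  ultimately show "(\<lambda>k. (pochhammer \<beta> k / fact k * c ^ k) * h s ^ k) sums (1 - c * h s) powr (- \<beta>)"
    by simp
qed

section \<open>The generating function of a power-fractional law\<close>

lemma PF_gf_alt:
  fixes a b \<theta> s :: real
  assumes "0 < \<theta>" "0 < a" "0 \<le> b" "s < 1"
  shows "1 - (a / (1 - s) powr \<theta> + b) powr (- 1 / \<theta>)
    = 1 - (1 - s) * (a + b * (1 - s) powr \<theta>) powr (- 1 / \<theta>)"
proof -
  have "a / (1 - s) powr \<theta> + b = (a + b * (1 - s) powr \<theta>) * (1 - s) powr (- \<theta>)"
    using assms by (simp add: field_simps powr_minus)
  also have "\<dots> powr (- 1 / \<theta>) = (a + b * (1 - s) powr \<theta>) powr (- 1 / \<theta>) * (1 - s)"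
    using assms by (simp add: powr_mult powr_powr)
  finally show ?thesis by simp
qed

text \<open>Both terms of the product rule contain the factor
  \<open>w powr (- (1 / \<theta> + 1))\<close>, with cofactors \<open>w\<close> and
  \<open>b * (1 - s) powr \<theta>\<close>. These differ by \<open>a\<close>, so the derivative
  collapses to a single power, to which the negative binomial series applies.\<close>

lemma PF_gf_deriv:
  fixes a b \<theta> s :: real
  assumes "0 < \<theta>" "0 < a" "0 \<le> b" "s < 1"
  shows "((\<lambda>s. 1 - (1 - s) * (a + b * (1 - s) powr \<theta>) powr (- 1 / \<theta>)) has_real_derivative
    a * (a + b * (1 - s) powr \<theta>) powr (- (1 / \<theta> + 1))) (at s)"
proof -
  define w where "w = a + b * (1 - s) powr \<theta>"
  have w: "0 < w" using assms by (auto simp: w_def intro!: add_pos_nonneg)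
  have u: "(1 - s) * (1 - s) powr (\<theta> - 1) = (1 - s) powr \<theta>"
    using assms by (simp add: powr_diff)
  have w1: "w powr (- 1 / \<theta>) = w * w powr (- (1 / \<theta> + 1))"
    using w powr_add[of w 1 "- (1 / \<theta> + 1)"] by simp
  have factor: "w * x - x * (b * y) = (w - b * y) * x" for x y
    by (simp add: algebra_simps)
  have expo: "- 1 / \<theta> - 1 = - (1 / \<theta> + 1)" by simp
  have "((\<lambda>s. 1 - (1 - s) * (a + b * (1 - s) powr \<theta>) powr (- 1 / \<theta>)) has_real_derivative
     (w powr (- 1 / \<theta>) - (1 - s) * ((- 1 / \<theta>) * w powr (- 1 / \<theta> - 1) * (b * (- \<theta> * (1 - s) powr (\<theta> - 1)))))) (at s)"
    unfolding w_def
    by (rule derivative_eq_intros refl | use assms w in \<open>simp add: w_def\<close>)+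
  also have "w powr (- 1 / \<theta>) - (1 - s) * ((- 1 / \<theta>) * w powr (- 1 / \<theta> - 1) * (b * (- \<theta> * (1 - s) powr (\<theta> - 1))))
     = w powr (- 1 / \<theta>) - w powr (- 1 / \<theta> - 1) * (b * ((1 - s) * (1 - s) powr (\<theta> - 1)))"
    using assms by simp
  also have "\<dots> = (w - b * (1 - s) powr \<theta>) * w powr (- (1 / \<theta> + 1))"
    unfolding u w1 expo by (rule factor)
  also have "w - b * (1 - s) powr \<theta> = a" by (simp add: w_def)
  finally show ?thesis by (simp add: w_def)
qed

lemma nonneg_powser_PF_gf:
  fixes a b \<theta> :: real
  assumes \<theta>: "0 < \<theta>" "\<theta> \<le> 1" and ab: "0 < a" "0 < b" "1 \<le> a + b"
  shows "nonneg_powser (\<lambda>s. 1 - (1 - s) * (a + b * (1 - s) powr \<theta>) powr (- 1 / \<theta>))"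
proof (rule nonneg_powser_antideriv)
  let ?h = "\<lambda>s. 1 - (1 - s) powr \<theta>" and ?c = "b / (a + b)" and ?\<beta> = "1 / \<theta> + 1"
  \<comment> \<open>The constant term is \<open>1 - (a + b) powr (- 1 / \<theta>)\<close>; its sign
    is where \<open>1 \<le> a + b\<close> enters.\<close>
  show "0 \<le> 1 - (1 - 0) * (a + b * (1 - 0) powr \<theta>) powr (- 1 / \<theta>)"
    using ab \<theta> powr_mono2'[of "- 1 / \<theta>" 1 "a + b"] by simp
  show "((\<lambda>s. 1 - (1 - s) * (a + b * (1 - s) powr \<theta>) powr (- 1 / \<theta>)) has_real_derivative
      (a * (a + b) powr - ?\<beta>) * (1 - ?c * ?h s) powr - ?\<beta>) (at s)" if s: "0 \<le> s" "s < 1" for s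
  proof -
    have *: "a + b * (1 - s) powr \<theta> = (a + b) * (1 - ?c * ?h s)"
      using ab by (simp add: field_simps)
    have "0 < a + b * (1 - s) powr \<theta>" using ab by (auto intro!: add_pos_nonneg)
    then have "0 < 1 - ?c * ?h s" unfolding * using ab by (simp add: zero_less_mult_iff)
    then have "(a + b * (1 - s) powr \<theta>) powr - ?\<beta> = (a + b) powr - ?\<beta> * (1 - ?c * ?h s) powr - ?\<beta>"
      unfolding * using ab by (intro powr_mult)
    then show ?thesis using PF_gf_deriv[of \<theta> a b s] \<theta> ab s by (simp add: mult.assoc)
  qed
  have h: "0 \<le> ?h s \<and> ?h s < 1" if "0 \<le> s" "s < 1" for s
    using that \<theta> powr_mono2[of \<theta> "1 - s" 1] by auto
  show "nonneg_powser (\<lambda>s. (a * (a + b) powr - ?\<beta>) * (1 - ?c * ?h s) powr - ?\<beta>)"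
    using ab \<theta> h
    by (intro nonneg_powser_mult nonneg_powser_const nonneg_powser_one_minus_mult_powr
        nonneg_powser_one_minus_powr) (auto simp: add_pos_pos)
qed

text \<open>Let s increase to 1. Every partial sum of \<open>c\<close> is the limit of polynomials
  bounded by \<open>f s\<close>, hence at most 1, while \<open>suminf c\<close> dominates
  \<open>f s\<close> and therefore \<open>1 - (1 - s) * C\<close>. Nonnegativity of the coefficients
  takes the place of Abel's theorem.\<close>

lemma sums_1_if_powser_tends_to_1:
  fixes c :: "nat \<Rightarrow> real"
  assumes c: "\<And>n. 0 \<le> c n"
    and f: "\<And>s. 0 \<le> s \<Longrightarrow> s < 1 \<Longrightarrow> (\<lambda>n. c n * s ^ n) sums f s"
    and le: "\<And>s. 0 \<le> s \<Longrightarrow> s < 1 \<Longrightarrow> f s \<le> 1"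
    and ge: "\<And>s. 0 \<le> s \<Longrightarrow> s < 1 \<Longrightarrow> 1 - (1 - s) * C \<le> f s"
  shows "c sums 1"
proof -
  have ev: "\<forall>\<^sub>F s in at_left (1::real). 0 \<le> s \<and> s < 1"
    by (rule eventually_at_leftI[of 0]) auto
  have part: "(\<Sum>i<n. c i) \<le> 1" for n
  proof (rule tendsto_upperbound)
    show "((\<lambda>s. \<Sum>i<n. c i * s ^ i) \<longlongrightarrow> (\<Sum>i<n. c i)) (at_left 1)"
      by (auto intro!: tendsto_eq_intros)
    show "\<forall>\<^sub>F s in at_left 1. (\<Sum>i<n. c i * s ^ i) \<le> 1"
      using ev
    proof eventually_elim
      case (elim s)
      have "(\<Sum>i<n. c i * s ^ i) \<le> f s"
        using f[of s] elim c sum_le_suminf[of "\<lambda>n. c n * s ^ n" "{..<n}"] by (auto simp: sums_iff)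
      with le[of s] elim show ?case by simp
    qed
  qed auto
  have summ: "summable c"
    by (rule summableI_nonneg_bounded[OF c part])
  have "suminf c \<le> 1" by (rule suminf_le_const[OF summ part])
  moreover have "1 \<le> suminf c"
  proof (rule tendsto_upperbound)
    show "((\<lambda>s. 1 - (1 - s) * C) \<longlongrightarrow> 1) (at_left 1)"
      by (auto intro!: tendsto_eq_intros)
    show "\<forall>\<^sub>F s in at_left 1. 1 - (1 - s) * C \<le> suminf c"
      using ev
    proof eventually_elim
      case (elim s)
      have "f s \<le> suminf c"
      proof -
        have "(\<Sum>n. c n * s ^ n) \<le> suminf c"
          using f[of s] elim summ c
          by (intro suminf_le) (auto simp: sums_iff intro!: mult_left_le power_le_one)
        with f[of s] elim show ?thesis by (simp add: sums_iff)
      qed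
      with ge[of s] elim show ?case by simp
    qed
  qed auto
  ultimately show ?thesis using summ by (simp add: sums_iff)
qed

lemma PF_exists:
  fixes a b \<theta> :: real
  assumes \<theta>: "0 < \<theta>" "\<theta> \<le> 1" and ab: "0 < a" "0 < b" "1 \<le> a + b"
  shows "\<exists>p :: nat pmf. \<forall>s\<in>{0..<1}.
    (\<Sum>n. pmf p n * s ^ n) = 1 - (a / (1 - s) powr \<theta> + b) powr (- 1 / \<theta>)"
proof -
  let ?g = "\<lambda>s. 1 - (1 - s) * (a + b * (1 - s) powr \<theta>) powr (- 1 / \<theta>)"
  obtain c where c: "\<And>n. 0 \<le> c n" "\<And>s. 0 \<le> s \<Longrightarrow> s < 1 \<Longrightarrow> (\<lambda>n. c n * s ^ n) sums ?g s"
    using nonneg_powser_PF_gf[OF assms] by (elim nonneg_powserE) blast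
  have "c sums 1"
  \<comment> \<open>The constant \<open>C\<close> is the mean of the law; it bounds the cofactor of
    \<open>1 - s\<close> because dropping the nonnegative term
    \<open>b * (1 - s) powr \<theta>\<close> raises a negative power.\<close>
  proof (rule sums_1_if_powser_tends_to_1[OF c, where C = "a powr (- 1 / \<theta>)"])
    fix s :: real assume s: "0 \<le> s" "s < 1"
    show "?g s \<le> 1" using s by simp
    have "(a + b * (1 - s) powr \<theta>) powr (- 1 / \<theta>) \<le> a powr (- 1 / \<theta>)"
      using ab \<theta> by (intro powr_mono2') auto
    then show "1 - (1 - s) * a powr (- 1 / \<theta>) \<le> ?g s"
      using s by (simp add: mult_left_mono)
  qed
  then have "(\<Sum>n. ennreal (c n)) = ennreal 1"
    by (rule suminf_ennreal_eq[OF c(1)])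
  then have c_pmf: "pmf (embed_pmf c) n = c n" for n
    by (intro pmf_embed_pmf c(1)) (simp only: nn_integral_count_space_nat ennreal_1)
  have "(\<Sum>n. c n * s ^ n) = 1 - (a / (1 - s) powr \<theta> + b) powr (- 1 / \<theta>)"
    if "0 \<le> s" "s < 1" for s
    unfolding sums_unique[OF c(2)[OF that], symmetric]
    by (rule PF_gf_alt[symmetric]) (use \<theta> ab that in auto)
  then show ?thesis by (intro exI[of _ "embed_pmf c"]) (simp add: c_pmf)
qed

section \<open>Generating functions and total variation\<close>

definition pgf :: "nat pmf \<Rightarrow> real \<Rightarrow> real" where
  "pgf p s = (\<Sum>n. pmf p n * s ^ n)"

lemma pmf_nat_sums: "pmf p sums 1" for p :: "nat pmf"
proof -
  have "(\<Sum>n. ennreal (pmf p n)) = 1"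
    by (simp add: nn_integral_pmf flip: nn_integral_count_space_nat)
  then have "(\<lambda>n. ennreal (pmf p n)) sums ennreal 1"
    by (simp add: sums_iff del: suminf_ennreal)
  then show ?thesis by (subst (asm) sums_ennreal) auto
qed

lemma summable_pgf:
  assumes "0 \<le> s" "s \<le> 1" shows "summable (\<lambda>n. pmf p n * s ^ n)"
  by (rule summable_comparison_test'[OF sums_summable[OF pmf_nat_sums[of p]], of 0])
    (use assms in \<open>auto intro!: mult_left_le power_le_one\<close>)

lemma nn_integral_power_eq_pgf:
  assumes "0 \<le> s" "s \<le> 1" shows "(\<integral>\<^sup>+n. ennreal (s ^ n) \<partial>measure_pmf p) = ennreal (pgf p s)"
proof -
  have "(\<integral>\<^sup>+n. ennreal (s ^ n) \<partial>measure_pmf p) = (\<Sum>n. ennreal (pmf p n * s ^ n))"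
    unfolding nn_integral_measure_pmf nn_integral_count_space_nat
    using assms by (intro suminf_cong) (simp add: ennreal_mult)
  also have "\<dots> = ennreal (pgf p s)"
    unfolding pgf_def by (rule suminf_ennreal2) (use assms summable_pgf in auto)
  finally show ?thesis .
qed

lemma pgf_nonneg: "0 \<le> s \<Longrightarrow> s \<le> 1 \<Longrightarrow> 0 \<le> pgf p s"
  unfolding pgf_def by (intro suminf_nonneg summable_pgf) auto

lemma pgf_le_1:
  assumes "0 \<le> s" "s \<le> 1" shows "pgf p s \<le> 1"
proof -
  have "pgf p s \<le> suminf (pmf p)"
    unfolding pgf_def using assms
    by (intro suminf_le summable_pgf sums_summable[OF pmf_nat_sums]) (auto intro!: mult_left_le power_le_one)
  then show ?thesis using pmf_nat_sums[of p] by (simp add: sums_iff)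
qed

lemma pgf_eqI:
  assumes "0 \<le> s" "s \<le> 1" "0 \<le> c" "(\<integral>\<^sup>+n. ennreal (s ^ n) \<partial>measure_pmf p) = ennreal c"
  shows "pgf p s = c"
  using assms nn_integral_power_eq_pgf[of s p] pgf_nonneg[of s p] by simp

text \<open>Removing the first k terms and dividing by \<open>s ^ k\<close> leaves
  \<open>pmf p k\<close> plus terms that all carry a factor \<open>s\<close> and have total mass at
  most 1. The error \<open>s\<close> does not depend on \<open>p\<close>, which permits a limit in
  \<open>p\<close> before s tends to 0.\<close>

lemma pgf_tail_bounds:
  assumes s: "0 < s" "s < 1"
  shows "pmf p k \<le> (pgf p s - (\<Sum>j<k. pmf p j * s ^ j)) / s ^ k"
    and "(pgf p s - (\<Sum>j<k. pmf p j * s ^ j)) / s ^ k \<le> pmf p k + s"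
proof -
  let ?t = "\<lambda>j. pmf p (j + k) * s ^ j"
  have summ: "summable (\<lambda>j. pmf p (j + k))" for k
    by (rule summable_ignore_initial_segment[OF sums_summable[OF pmf_nat_sums]])
  have summt: "summable ?t"
    by (rule summable_comparison_test'[OF summ[of k], of 0])
      (use s in \<open>auto intro!: mult_left_le power_le_one\<close>)
  have "pgf p s - (\<Sum>j<k. pmf p j * s ^ j) = (\<Sum>j. pmf p (j + k) * s ^ (j + k))"
    unfolding pgf_def using s by (intro suminf_minus_initial_segment[symmetric] summable_pgf) auto
  also have "\<dots> = s ^ k * suminf ?t"
    using summt by (subst suminf_mult[symmetric]) (auto simp: power_add mult_ac)
  finally have eq: "(pgf p s - (\<Sum>j<k. pmf p j * s ^ j)) / s ^ k = suminf ?t"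
    using s by simp
  have split: "suminf ?t = pmf p k + (\<Sum>j. pmf p (Suc j + k) * s ^ Suc j)"
    using suminf_split_head[OF summt] by simp
  have "(\<Sum>j. pmf p (j + Suc k)) \<le> 1"
    using suminf_minus_initial_segment[OF sums_summable[OF pmf_nat_sums], of p "Suc k"]
      sums_unique[OF pmf_nat_sums[of p]] sum_nonneg[of "{..<Suc k}" "pmf p"] by simp
  then have le1: "s * (\<Sum>j. pmf p (j + Suc k)) \<le> s" using s by (simp add: mult_left_le)
  have summt': "summable (\<lambda>j. pmf p (Suc j + k) * s ^ Suc j)"
    using summt by (subst summable_Suc_iff)
  have "(\<Sum>j. pmf p (Suc j + k) * s ^ Suc j) \<le> (\<Sum>j. s * pmf p (j + Suc k))"
  proof (rule suminf_le[OF _ summt' summable_mult[OF summ]])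
    fix j
    have "s ^ Suc j \<le> s" using s by (simp add: mult_left_le power_le_one)
    then have "s ^ Suc j * pmf p (j + Suc k) \<le> s * pmf p (j + Suc k)" by (intro mult_right_mono) auto
    then show "pmf p (Suc j + k) * s ^ Suc j \<le> s * pmf p (j + Suc k)" by (simp add: mult_ac)
  qed
  also have "\<dots> \<le> s" using le1 by (simp only: suminf_mult[OF summ])
  finally have "(\<Sum>j. pmf p (Suc j + k) * s ^ Suc j) \<le> s" .
  moreover have "0 \<le> (\<Sum>j. pmf p (Suc j + k) * s ^ Suc j)"
    using s by (intro suminf_nonneg summt') auto
  ultimately show "pmf p k \<le> (pgf p s - (\<Sum>j<k. pmf p j * s ^ j)) / s ^ k"
    and "(pgf p s - (\<Sum>j<k. pmf p j * s ^ j)) / s ^ k \<le> pmf p k + s"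
    unfolding eq split by linarith+
qed

text \<open>Strong induction on k: the masses below k converge already, so the normalised tail in
  \<open>pgf_tail_bounds\<close> converges, and it approximates the mass at k uniformly.\<close>

lemma tendsto_pmf_if_tendsto_pgf:
  assumes lim: "\<And>s. 0 < s \<Longrightarrow> s < 1 \<Longrightarrow> (\<lambda>m. pgf (P m) s) \<longlonglongrightarrow> pgf q s"
  shows "(\<lambda>m. pmf (P m) k) \<longlonglongrightarrow> pmf q k"
proof (induction k rule: less_induct)
  case (less k)
  let ?T = "\<lambda>p s. (pgf p s - (\<Sum>j<k. pmf p j * s ^ j)) / s ^ k"
  show ?case
  proof (rule tendstoI)
    fix e :: real assume "0 < e"
    \<comment> \<open>One half of \<open>e\<close> pays for the error \<open>s\<close> of the tail
      bounds, the other for the distance of the two tails; the 1/2 keeps \<open>s\<close> below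
      1.\<close>
    define s where "s = min (1/2) (e/2)"
    have s: "0 < s" "s < 1" "s \<le> e/2" using \<open>0 < e\<close> by (auto simp: s_def)
    have "(\<lambda>m. ?T (P m) s) \<longlonglongrightarrow> ?T q s"
      using s by (intro tendsto_intros lim less) auto
    then have "\<forall>\<^sub>F m in sequentially. dist (?T (P m) s) (?T q s) < e / 2"
      using \<open>0 < e\<close> by (intro tendstoD) auto
    then show "\<forall>\<^sub>F m in sequentially. dist (pmf (P m) k) (pmf q k) < e"
    proof eventually_elim
      case (elim m)
      with pgf_tail_bounds[OF s(1,2), where p = "P m" and k = k]
        pgf_tail_bounds[OF s(1,2), where p = q and k = k] s(3)
      show ?case unfolding dist_real_def by linarith
    qed
  qed
qed

text \<open>Uniqueness is the convergence statement for a constant sequence.\<close>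

lemma pmf_eqI_pgf:
  assumes "\<And>s. 0 < s \<Longrightarrow> s < 1 \<Longrightarrow> pgf p s = pgf q s"
  shows "p = q"
proof (rule pmf_eqI)
  fix k
  have "(\<lambda>_::nat. pmf p k) \<longlonglongrightarrow> pmf q k"
    by (rule tendsto_pmf_if_tendsto_pgf) (simp add: assms)
  then show "pmf p k = pmf q k" by (simp add: LIMSEQ_const_iff)
qed

text \<open>All mass functions have integral 1 under counting measure, so Scheffe's lemma upgrades
  pointwise to L1 convergence, and the L1 distance bounds the difference of the probabilities of
  every set.\<close>

lemma tendsto_tv_dist_if_tendsto_pmf:
  fixes P :: "nat \<Rightarrow> 'a pmf"
  assumes "\<And>x. (\<lambda>m. pmf (P m) x) \<longlonglongrightarrow> pmf q x"
  shows "(\<lambda>m. tv_dist (P m) q) \<longlonglongrightarrow> 0"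
proof -
  let ?D = "\<lambda>m x. norm (pmf (P m) x - pmf q x)"
  have int: "integrable (count_space UNIV) (?D m)" for m
    by (intro integrable_norm Bochner_Integration.integrable_diff integrable_pmf)
  have "(\<lambda>m. \<integral>\<^sup>+x. ?D m x \<partial>count_space UNIV) \<longlonglongrightarrow> 0"
    by (rule Scheffe_lemma2) (auto simp: assms integrable_pmf nn_integral_pmf)
  then have "(\<lambda>m. ennreal (integral\<^sup>L (count_space UNIV) (?D m))) \<longlonglongrightarrow> ennreal 0"
    using nn_integral_eq_integral[OF int] by simp
  then have D: "(\<lambda>m. integral\<^sup>L (count_space UNIV) (?D m)) \<longlonglongrightarrow> 0"
    by (subst (asm) tendsto_ennreal_iff) auto
  have le: "\<bar>measure_pmf.prob (P m) S - measure_pmf.prob q S\<bar> \<le> integral\<^sup>L (count_space UNIV) (?D m)" for m S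
  proof -
    have "measure_pmf.prob (P m) S - measure_pmf.prob q S
        = (\<integral>x. pmf (P m) x - pmf q x \<partial>count_space S)"
      by (simp add: integral_pmf Bochner_Integration.integral_diff integrable_pmf)
    also have "norm \<dots> \<le> integral\<^sup>L (count_space S) (?D m)"
      by (rule integral_norm_bound)
    also have "\<dots> = (\<integral>x. indicator S x *\<^sub>R ?D m x \<partial>count_space UNIV)"
      by (subst integral_restrict_space[symmetric]) (auto simp: restrict_count_space)
    also have "\<dots> \<le> integral\<^sup>L (count_space UNIV) (?D m)"
      by (rule integral_mono[OF integrable_mult_indicator int])
        (auto simp: int[simplified] indicator_def)
    finally show ?thesis by simp
  qed
  show ?thesis
  proof (rule tendsto_sandwich[OF _ _ tendsto_const D])
    \<comment> \<open>The supremum is compared with its value at the empty set, which requires that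
      the differences be bounded above.\<close>
    show "\<forall>\<^sub>F m in sequentially. 0 \<le> tv_dist (P m) q"
      unfolding tv_dist_def
      by (intro always_eventually allI cSUP_upper2[where x = "{}"])
        (auto intro!: bdd_aboveI2 le[simplified])
    show "\<forall>\<^sub>F m in sequentially. tv_dist (P m) q \<le> integral\<^sup>L (count_space UNIV) (?D m)"
      unfolding tv_dist_def by (intro always_eventually allI cSUP_least le) auto
  qed
qed

text \<open>Resolves the definite description in \<open>PF\<close>: \<open>p\<close> is a witness by
  assumption, and \<open>pmf_eqI_pgf\<close> makes it the only one.\<close>

lemma PF_eqI:
  assumes "\<And>s. 0 \<le> s \<Longrightarrow> s < 1 \<Longrightarrow> pgf p s = 1 - (a / (1 - s) powr \<theta> + b) powr (- 1 / \<theta>)"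
  shows "PF \<theta> a b = p"
  unfolding PF_def
proof (rule the_equality)
  fix q assume "\<forall>s\<in>{0..<1}. (\<Sum>n. pmf q n * s ^ n) = 1 - (a / (1 - s) powr \<theta> + b) powr (- 1 / \<theta>)"
  then show "q = p" by (intro pmf_eqI_pgf) (auto simp: assms pgf_def[of q])
qed (use assms in \<open>auto simp: pgf_def\<close>)

lemma pgf_PF:
  assumes \<theta>: "0 < \<theta>" "\<theta> \<le> 1" and ab: "0 < a" "0 < b" "1 \<le> a + b" and s: "0 \<le> s" "s < 1"
  shows "pgf (PF \<theta> a b) s = 1 - (a / (1 - s) powr \<theta> + b) powr (- 1 / \<theta>)"
proof -
  obtain p where p: "\<forall>s\<in>{0..<1}. pgf p s = 1 - (a / (1 - s) powr \<theta> + b) powr (- 1 / \<theta>)"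
    using PF_exists[OF \<theta> ab] unfolding pgf_def by blast
  then have "PF \<theta> a b = p" by (intro PF_eqI) auto
  with p s show ?thesis by simp
qed

section \<open>Quenched laws\<close>

text \<open>A property of a law, not an equation with \<open>PF\<close>, so that d = 0 is covered as
  well: generation 0 has parameters 1 and 0, outside the range of \<open>pgf_PF\<close>.\<close>

definition has_PF_gf :: "real \<Rightarrow> real \<Rightarrow> real \<Rightarrow> nat pmf \<Rightarrow> bool" where
  "has_PF_gf \<theta> c d p \<longleftrightarrow> (\<forall>s. 0 \<le> s \<longrightarrow> s < 1 \<longrightarrow> pgf p s = 1 - (c / (1 - s) powr \<theta> + d) powr (- 1 / \<theta>))"

lemma pmf_0_eq_pgf: "pmf p 0 = pgf p 0"
proof -
  have "(\<lambda>n. pmf p n * 0 ^ n) = (\<lambda>n. if n = 0 then pmf p 0 else 0)" by auto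
  then show ?thesis using sums_single[of 0 "\<lambda>_. pmf p 0"] by (simp add: pgf_def sums_iff)
qed

lemma prob_positive_nat: "measure_pmf.prob p {0<..} = 1 - pmf p 0" for p :: "nat pmf"
proof -
  have "{0<..} = - {0::nat}" by auto
  then show ?thesis
    using measure_pmf.prob_compl[of "{0}" p] by (simp add: measure_pmf_single Compl_eq_Diff_UNIV)
qed

lemma prob_positive_PF_gf:
  assumes "has_PF_gf \<theta> c d p"
  shows "measure_pmf.prob p {0<..} = (c + d) powr (- 1 / \<theta>)"
  using assms by (simp add: prob_positive_nat pmf_0_eq_pgf has_PF_gf_def)

text \<open>Conditioning on a positive value turns 1 - f into (1 - f) / (1 - f(0)). Since 1 - f(0)
  is \<open>(c + d) powr (- 1 / \<theta>)\<close>, the quotient amounts to dividing the affine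
  argument by \<open>c + d\<close>.\<close>

lemma cond_pmf_PF_gf:
  assumes p: "has_PF_gf \<theta> c d p" and cd: "0 < c" "0 \<le> d"
  shows "has_PF_gf \<theta> (c / (c + d)) (d / (c + d)) (cond_pmf p {0<..})"
proof -
  let ?\<pi> = "(c + d) powr (- 1 / \<theta>)"
  have \<pi>: "0 < ?\<pi>" using cd by simp
  have p0: "pmf p 0 = 1 - ?\<pi>" using prob_positive_PF_gf[OF p] by (simp add: prob_positive_nat)
  \<comment> \<open>\<open>cond_pmf\<close> is meaningful only when the conditioning event meets the
    support.\<close>
  have ne: "set_pmf p \<inter> {0<..} \<noteq> {}"
    using \<pi> prob_positive_PF_gf[OF p] measure_Int_set_pmf[of p "{0<..}"]
    by (auto simp: Int_commute)
  have "pgf (cond_pmf p {0<..}) s = 1 - (c / (c + d) / (1 - s) powr \<theta> + d / (c + d)) powr (- 1 / \<theta>)"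
    if s: "0 \<le> s" "s < 1" for s
  proof -
    let ?X = "c / (1 - s) powr \<theta> + d"
    have X: "0 < ?X" using cd s by (auto intro!: add_pos_nonneg)
    have "(\<lambda>n. pmf p n * s ^ n) sums (1 - ?X powr (- 1 / \<theta>))"
      using p s summable_pgf[of s p] by (auto simp: has_PF_gf_def pgf_def sums_iff)
    from sums_diff[OF this sums_single[of 0 "\<lambda>_. pmf p 0"]]
    have "(\<lambda>n. pmf p n * s ^ n - (if n = 0 then pmf p 0 else 0)) sums (?\<pi> - ?X powr (- 1 / \<theta>))"
      by (simp add: p0)
    from sums_divide[OF this, of ?\<pi>]
    have "(\<lambda>n. (pmf p n * s ^ n - (if n = 0 then pmf p 0 else 0)) / ?\<pi>) sums (1 - ?X powr (- 1 / \<theta>) / ?\<pi>)"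
      using \<pi> by (simp add: diff_divide_distrib)
    also have "(\<lambda>n. (pmf p n * s ^ n - (if n = 0 then pmf p 0 else 0)) / ?\<pi>)
        = (\<lambda>n. pmf (cond_pmf p {0<..}) n * s ^ n)"
      by (auto simp: pmf_cond[OF ne] prob_positive_PF_gf[OF p])
    also have "?X powr (- 1 / \<theta>) / ?\<pi> = (?X / (c + d)) powr (- 1 / \<theta>)"
      using X cd by (simp add: powr_divide)
    also have "?X / (c + d) = c / (c + d) / (1 - s) powr \<theta> + d / (c + d)"
      by (simp add: add_divide_distrib mult.commute)
    finally show ?thesis unfolding pgf_def by (rule sums_unique[symmetric])
  qed
  then show ?thesis by (simp add: has_PF_gf_def)
qed

text \<open>The quotient (1 - f(s)) / (1 - s) is the expectation of the geometric sum of
  \<open>s ^ j\<close> over j < n, which increases to n as s increases to 1. Monotone convergence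
  gives the mean, and the explicit quotient
  \<open>(c + d * (1 - s) powr \<theta>) powr (- 1 / \<theta>)\<close> gives its value.\<close>

lemma mean_PF_gf:
  assumes p: "has_PF_gf \<theta> c d p" and \<theta>: "0 < \<theta>" and cd: "0 < c" "0 \<le> d"
  shows "(\<integral>\<^sup>+n. of_nat n \<partial>measure_pmf p) = ennreal (c powr (- 1 / \<theta>))"
proof -
  define s where "s m = 1 - 1 / real (Suc m)" for m
  have s: "0 \<le> s m" "s m < 1" for m by (auto simp: s_def)
  have s_lim: "s \<longlonglongrightarrow> 1" unfolding s_def
    using tendsto_diff[OF tendsto_const LIMSEQ_inverse_real_of_nat, of 1] by (simp add: field_simps)
  have s_mono: "s m \<le> s n" if "m \<le> n" for m n
    using that by (auto simp: s_def intro!: divide_left_mono)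
  let ?f = "\<lambda>m n. ennreal (\<Sum>j<n. s m ^ j)"
  have int: "(\<integral>\<^sup>+n. ?f m n \<partial>measure_pmf p) = ennreal ((c + d * (1 - s m) powr \<theta>) powr (- 1 / \<theta>))" for m
  proof -
    have "(\<integral>\<^sup>+n. ?f m n \<partial>measure_pmf p) * ennreal (1 - s m)
        = (\<integral>\<^sup>+n. ?f m n * ennreal (1 - s m) \<partial>measure_pmf p)"
      by (simp add: nn_integral_multc)
    also have "\<dots> = (\<integral>\<^sup>+n. 1 - ennreal (s m ^ n) \<partial>measure_pmf p)"
    proof (rule nn_integral_cong)
      fix n
      have "(\<Sum>j<n. s m ^ j) * (1 - s m) = 1 - s m ^ n"
        using one_diff_power_eq[of "s m" n] by (simp add: mult.commute)
      then show "?f m n * ennreal (1 - s m) = 1 - ennreal (s m ^ n)"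
        using s[of m] by (simp flip: ennreal_mult ennreal_1 add: sum_nonneg ennreal_minus)
    qed
    also have "\<dots> = 1 - ennreal (pgf p (s m))"
      using s[of m] nn_integral_power_eq_pgf[of "s m" p]
      by (subst nn_integral_diff) (auto intro!: power_le_one)
    also have "\<dots> = ennreal (1 - pgf p (s m))"
      using s[of m] pgf_nonneg[of "s m" p] by (simp flip: ennreal_1 add: ennreal_minus)
    also have "1 - pgf p (s m) = (c + d * (1 - s m) powr \<theta>) powr (- 1 / \<theta>) * (1 - s m)"
      using p s[of m] PF_gf_alt[of \<theta> c d "s m"] \<theta> cd by (simp add: has_PF_gf_def)
    also have "ennreal \<dots> = ennreal ((c + d * (1 - s m) powr \<theta>) powr (- 1 / \<theta>)) * ennreal (1 - s m)"
      using s[of m] by (intro ennreal_mult) auto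
    finally have "(\<integral>\<^sup>+n. ?f m n \<partial>measure_pmf p) * ennreal (1 - s m) / ennreal (1 - s m)
        = ennreal ((c + d * (1 - s m) powr \<theta>) powr (- 1 / \<theta>)) * ennreal (1 - s m) / ennreal (1 - s m)"
      by simp
    then show ?thesis
      using s[of m] by (subst (asm) (1 2) ennreal_mult_divide_eq) auto
  qed
  have "(\<lambda>m. \<integral>\<^sup>+n. ?f m n \<partial>measure_pmf p) \<longlonglongrightarrow> (\<integral>\<^sup>+n. of_nat n \<partial>measure_pmf p)"
  proof (rule nn_integral_LIMSEQ)
    show "incseq (\<lambda>m n. ?f m n)"
      using s s_mono by (auto simp: incseq_def le_fun_def intro!: ennreal_leI sum_mono power_mono)
    fix n
    have "(\<lambda>m. \<Sum>j<n. s m ^ j) \<longlonglongrightarrow> (\<Sum>j<n. 1 ^ j)"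
      by (intro tendsto_intros s_lim)
    then have "(\<lambda>m. ?f m n) \<longlonglongrightarrow> ennreal (real n)"
      by (intro tendsto_ennrealI) simp
    then show "(\<lambda>m. ?f m n) \<longlonglongrightarrow> of_nat n" by (simp add: ennreal_of_nat_eq_real_of_nat)
  qed auto
  moreover have "(\<lambda>m. ennreal ((c + d * (1 - s m) powr \<theta>) powr (- 1 / \<theta>))) \<longlonglongrightarrow> ennreal (c powr (- 1 / \<theta>))"
  proof (rule tendsto_ennrealI)
    have "(\<lambda>m. 1 - s m) \<longlonglongrightarrow> 1 - 1" by (intro tendsto_intros s_lim)
    then have "(\<lambda>m. (1 - s m) powr \<theta>) \<longlonglongrightarrow> 0 powr \<theta>"
      using \<theta> s by (intro tendsto_powr') (auto intro!: always_eventually less_imp_le)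
    then have "(\<lambda>m. c + d * (1 - s m) powr \<theta>) \<longlonglongrightarrow> c + d * 0"
      using \<theta> by (intro tendsto_intros) auto
    then show "(\<lambda>m. (c + d * (1 - s m) powr \<theta>) powr (- 1 / \<theta>)) \<longlonglongrightarrow> c powr (- 1 / \<theta>)"
      using cd by (intro tendsto_intros) auto
  qed
  ultimately show ?thesis unfolding int by (rule LIMSEQ_unique)
qed

lemma nn_integral_power_sum_list_replicate_pmf:
  assumes "0 \<le> s" "s \<le> 1"
  shows "(\<integral>\<^sup>+xs. ennreal (s ^ sum_list xs) \<partial>measure_pmf (replicate_pmf k p)) = ennreal (pgf p s ^ k)"
proof (induction k)
  case (Suc k)
  have "(\<integral>\<^sup>+xs. ennreal (s ^ sum_list xs) \<partial>measure_pmf (replicate_pmf (Suc k) p))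
      = (\<integral>\<^sup>+x. ennreal (s ^ x) * ennreal (pgf p s ^ k) \<partial>measure_pmf p)"
    using assms Suc by (simp add: power_add ennreal_mult nn_integral_cmult)
  also have "\<dots> = ennreal (pgf p s ^ Suc k)"
    using assms by (simp add: nn_integral_multc nn_integral_power_eq_pgf pgf_nonneg ennreal_mult)
  finally show ?case .
qed simp

text \<open>Given generation n, its offspring counts are independent, so each individual contributes
  one factor \<open>pgf (q (Suc n)) s\<close>. The newest offspring law thus enters innermost in the
  composition.\<close>

lemma pgf_gw_path_Suc:
  assumes s: "0 \<le> s" "s \<le> 1"
  shows "pgf (map_pmf last (gw_path q (Suc n))) s = pgf (map_pmf last (gw_path q n)) (pgf (q (Suc n)) s)"
proof (rule pgf_eqI[OF s])
  let ?t = "pgf (q (Suc n)) s"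
  have t: "0 \<le> ?t" "?t \<le> 1" using pgf_nonneg pgf_le_1 s by auto
  show "0 \<le> pgf (map_pmf last (gw_path q n)) ?t" by (rule pgf_nonneg[OF t])
  show "(\<integral>\<^sup>+n. ennreal (s ^ n) \<partial>measure_pmf (map_pmf last (gw_path q (Suc n))))
      = ennreal (pgf (map_pmf last (gw_path q n)) ?t)"
    using nn_integral_power_eq_pgf[OF t, of "map_pmf last (gw_path q n)"]
    by (simp add: nn_integral_power_sum_list_replicate_pmf[OF s])
qed

lemma length_gw_path: "zs \<in> set_pmf (gw_path q n) \<Longrightarrow> length zs = Suc n"
  by (induction n arbitrary: zs) auto

lemma map_nth_gw_path: "map_pmf (\<lambda>zs. zs ! n) (gw_path q n) = map_pmf last (gw_path q n)"
proof (rule map_pmf_cong[OF refl])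
  fix zs assume "zs \<in> set_pmf (gw_path q n)"
  then have "length zs = Suc n" by (rule length_gw_path)
  then show "zs ! n = last zs" by (subst last_conv_nth) auto
qed

lemma env_Pi_Suc: "env_Pi a (Suc n) = env_Pi a n * a (Suc n)"
  by (simp add: env_Pi_def)

lemma env_R_Suc: "env_R a b (Suc n) = env_R a b n + env_Pi a n * b (Suc n)"
  by (simp add: env_R_def)

lemma env_Pi_pos: "(\<And>k. 1 \<le> k \<Longrightarrow> k \<le> n \<Longrightarrow> 0 < a k) \<Longrightarrow> 0 < env_Pi a n"
  unfolding env_Pi_def by (intro prod_pos) auto

lemma env_R_nonneg: "(\<And>k. 1 \<le> k \<Longrightarrow> k \<le> n \<Longrightarrow> 0 < a k \<and> 0 < b k) \<Longrightarrow> 0 \<le> env_R a b n"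
  unfolding env_R_def by (intro sum_nonneg mult_nonneg_nonneg less_imp_le env_Pi_pos) auto

text \<open>Induction on n, starting from the identity with parameters 1 and 0. The recursions for
  \<open>env_Pi\<close> and \<open>env_R\<close> are those of composing the affine map with slope
  \<open>env_Pi a n\<close> and intercept \<open>env_R a b n\<close> with the one with slope
  \<open>a (Suc n)\<close> and intercept \<open>b (Suc n)\<close>.\<close>

lemma quenched_law_PF_gf:
  assumes \<theta>: "0 < \<theta>" "\<theta> \<le> 1" and ab: "\<And>k. 1 \<le> k \<Longrightarrow> k \<le> n \<Longrightarrow> 0 < a k \<and> 0 < b k \<and> 1 \<le> a k + b k"
  shows "has_PF_gf \<theta> (env_Pi a n) (env_R a b n) (map_pmf last (quenched_law \<theta> a b n))"
  unfolding has_PF_gf_def using ab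
proof (induction n)
  case 0
  have "pgf (return_pmf 1) s = 1 - (1 / (1 - s) powr \<theta>) powr (- 1 / \<theta>)" if "0 \<le> s" "s < 1" for s
  proof -
    have "(1 / (1 - s) powr \<theta>) powr (- 1 / \<theta>) = ((1 - s) powr - \<theta>) powr (- 1 / \<theta>)"
      using that by (simp add: powr_minus divide_inverse)
    also have "\<dots> = 1 - s" using that \<theta> by (simp add: powr_powr)
    finally show ?thesis by (intro pgf_eqI) (use that in auto)
  qed
  then show ?case by (simp add: quenched_law_def env_Pi_def env_R_def)
next
  case (Suc n)
  show ?case
  proof (intro allI impI)
    fix s :: real assume s: "0 \<le> s" "s < 1"
    let ?a = "a (Suc n)" and ?b = "b (Suc n)"
    have ab: "0 < ?a" "0 < ?b" "1 \<le> ?a + ?b" using Suc.prems[of "Suc n"] by auto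
    define X where "X = ?a / (1 - s) powr \<theta> + ?b"
    have X: "0 < X" using ab s by (auto simp: X_def intro!: add_nonneg_pos)
    let ?t = "pgf (PF \<theta> ?a ?b) s"
    have t: "?t = 1 - X powr (- 1 / \<theta>)" unfolding X_def by (rule pgf_PF[OF \<theta> ab s])
    have t01: "0 \<le> ?t" "?t < 1" using s X by (auto simp: pgf_nonneg) (simp add: t)
    have "(1 - ?t) powr \<theta> = X powr (- 1)"
      using \<theta> by (simp add: t powr_powr del: minus_divide_left)
    then have tX: "(1 - ?t) powr \<theta> = inverse X"
      using X by (simp add: powr_minus)
    have "pgf (map_pmf last (quenched_law \<theta> a b (Suc n))) s
        = pgf (map_pmf last (quenched_law \<theta> a b n)) ?t"
      unfolding quenched_law_def using s by (intro pgf_gw_path_Suc) auto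
    also have "\<dots> = 1 - (env_Pi a n / (1 - ?t) powr \<theta> + env_R a b n) powr (- 1 / \<theta>)"
      using Suc t01 by auto
    also have "env_Pi a n / (1 - ?t) powr \<theta> + env_R a b n
        = env_Pi a (Suc n) / (1 - s) powr \<theta> + env_R a b (Suc n)"
    proof -
      have "env_Pi a n / (1 - ?t) powr \<theta> = env_Pi a n * X" using X by (simp add: tX divide_inverse)
      then show ?thesis by (simp add: env_Pi_Suc env_R_Suc X_def algebra_simps)
    qed
    finally show "pgf (map_pmf last (quenched_law \<theta> a b (Suc n))) s
        = 1 - (env_Pi a (Suc n) / (1 - s) powr \<theta> + env_R a b (Suc n)) powr (- 1 / \<theta>)" .
  qed
qed

section \<open>The random environment\<close>

context sigma_finite_subalgebra
begin

text \<open>Monotone convergence on each set of the subalgebra verifies the defining property of the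
  conditional expectation.\<close>

lemma nn_cond_exp_suminf:
  assumes [measurable]: "\<And>i::nat. f i \<in> borel_measurable M"
  shows "AE x in M. (\<Sum>i. nn_cond_exp M F (f i) x) = nn_cond_exp M F (\<lambda>x. \<Sum>i. f i x) x"
proof (rule nn_cond_exp_charact)
  fix A assume A: "A \<in> sets F"
  then have [measurable]: "A \<in> sets F" "A \<in> sets M" using subalg by (auto simp: subalgebra_def)
  have "(\<integral>\<^sup>+x\<in>A. (\<Sum>i. f i x) \<partial>M) = (\<integral>\<^sup>+x. (\<Sum>i. indicator A x * f i x) \<partial>M)"
    by (simp add: ennreal_suminf_cmult mult.commute)
  also have "\<dots> = (\<Sum>i. \<integral>\<^sup>+x. indicator A x * f i x \<partial>M)"
    by (rule nn_integral_suminf) auto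
  also have "\<dots> = (\<Sum>i. \<integral>\<^sup>+x. indicator A x * nn_cond_exp M F (f i) x \<partial>M)"
    using A by (simp add: nn_cond_exp_intg)
  also have "\<dots> = (\<integral>\<^sup>+x. (\<Sum>i. indicator A x * nn_cond_exp M F (f i) x) \<partial>M)"
    by (rule nn_integral_suminf[symmetric]) auto
  also have "\<dots> = (\<integral>\<^sup>+x\<in>A. (\<Sum>i. nn_cond_exp M F (f i) x) \<partial>M)"
    by (simp add: ennreal_suminf_cmult mult.commute)
  finally show "(\<integral>\<^sup>+x\<in>A. (\<Sum>i. f i x) \<partial>M) = (\<integral>\<^sup>+x\<in>A. (\<Sum>i. nn_cond_exp M F (f i) x) \<partial>M)" .
qed auto

text \<open>The real version subtracts the negative part, here 0, after applying
  \<open>enn2real\<close>. The positive part is at most 1 almost everywhere, so the conversion loses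
  nothing.\<close>

lemma real_cond_exp_indicator_eq_nn_cond_exp:
  assumes [measurable]: "E \<in> sets M"
  shows "AE x in M. ennreal (real_cond_exp M F (indicator E) x) = nn_cond_exp M F (indicator E) x"
proof -
  have "(\<lambda>x. ennreal (- indicator E x)) = (\<lambda>_. 0)"
    by (auto simp: ennreal_neg)
  then have "AE x in M. 0 = nn_cond_exp M F (\<lambda>x. ennreal (- indicator E x)) x"
    using nn_cond_exp_F_meas[of "\<lambda>_. 0"] by simp
  moreover have "AE x in M. nn_cond_exp M F (indicator E) x \<le> nn_cond_exp M F (\<lambda>_. 1) x"
    by (rule nn_cond_exp_mono) (auto simp: indicator_def)
  moreover have "AE x in M. 1 = nn_cond_exp M F (\<lambda>_. 1) x"
    by (rule nn_cond_exp_F_meas) auto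
  ultimately show ?thesis
  proof eventually_elim
    case (elim x)
    then have "nn_cond_exp M F (indicator E) x < top"
      by (simp add: le_less_trans[OF _ ennreal_one_less_top])
    then show ?case using elim by (simp add: real_cond_exp_def ennreal_indicator)
  qed
qed

end

section \<open>Partial sums of the inverse series and time reversal\<close>

definition env_S :: "(nat \<Rightarrow> real) \<Rightarrow> (nat \<Rightarrow> real) \<Rightarrow> nat \<Rightarrow> real" where
  "env_S a b n = (\<Sum>k=1..n. b k / env_Pi a k)"

lemma env_Pi_Suc_shift: "env_Pi a (Suc n) = a 1 * env_Pi (\<lambda>k. a (Suc k)) n"
  by (induction n) (simp_all add: env_Pi_def)

lemma env_S_Suc_shift:
  "env_S a b (Suc n) = (b 1 + env_S (\<lambda>k. a (Suc k)) (\<lambda>k. b (Suc k)) n) / a 1"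
proof -
  have "env_S a b (Suc n) = b 1 / env_Pi a 1 + (\<Sum>k=1..n. b (Suc k) / env_Pi a (Suc k))"
    unfolding env_S_def
    using sum.shift_bounds_cl_Suc_ivl[of "\<lambda>k. b k / env_Pi a k" 1 n]
    by (subst sum.atLeast_Suc_atMost) (simp_all del: sum.cl_ivl_Suc sum.shift_bounds_cl_Suc_ivl)
  also have "(\<Sum>k=1..n. b (Suc k) / env_Pi a (Suc k)) = env_S (\<lambda>k. a (Suc k)) (\<lambda>k. b (Suc k)) n / a 1"
    by (simp add: env_S_def env_Pi_Suc_shift sum_divide_distrib mult.commute)
  finally show ?thesis by (simp add: env_Pi_def add_divide_distrib)
qed

lemma env_Pi_cong: "(\<And>k. 1 \<le> k \<Longrightarrow> k \<le> n \<Longrightarrow> a k = a' k) \<Longrightarrow> env_Pi a n = env_Pi a' n"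
  unfolding env_Pi_def by (intro prod.cong) auto

lemma env_S_cong:
  "(\<And>k. 1 \<le> k \<Longrightarrow> k \<le> n \<Longrightarrow> a k = a' k \<and> b k = b' k) \<Longrightarrow> env_S a b n = env_S a' b' n"
  unfolding env_S_def
  by (intro sum.cong refl arg_cong2[where f = "(/)"] env_Pi_cong) auto

text \<open>Both sides start at 0 and satisfy r(n+1) = (b(n+1) + r(n)) / a(n+1). On the right, the
  entry with index n+1 comes first in the reversed order and is split off by
  \<open>env_S_Suc_shift\<close>.\<close>

lemma env_R_div_Pi:
  assumes "\<And>k. 1 \<le> k \<Longrightarrow> k \<le> n \<Longrightarrow> a k \<noteq> 0"
  shows "env_R a b n / env_Pi a n = env_S (\<lambda>k. a (n + 1 - k)) (\<lambda>k. b (n + 1 - k)) n"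
  using assms
proof (induction n)
  case 0
  then show ?case by (simp add: env_R_def env_S_def)
next
  case (Suc n)
  have "env_Pi a n \<noteq> 0" using Suc.prems by (auto simp: env_Pi_def)
  then have "env_R a b (Suc n) / env_Pi a (Suc n)
      = (b (Suc n) + env_R a b n / env_Pi a n) / a (Suc n)"
    using Suc.prems[of "Suc n"] by (simp add: env_R_Suc env_Pi_Suc field_simps)
  also have "\<dots> = env_S (\<lambda>k. a (Suc n + 1 - k)) (\<lambda>k. b (Suc n + 1 - k)) (Suc n)"
    using Suc by (subst env_S_Suc_shift) simp
  finally show ?case .
qed

lemma (in prob_space) weak_conv_m_if_AE_tendsto:
  assumes [measurable]: "\<And>n. X n \<in> borel_measurable M" "Y \<in> borel_measurable M"
    and lim: "AE \<omega> in M. (\<lambda>n. X n \<omega>) \<longlonglongrightarrow> (Y \<omega> :: real)"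
  shows "weak_conv_m (\<lambda>n. distr M borel (X n)) (distr M borel Y)"
proof (rule integral_bdd_continuous_conv_imp_weak_conv)
  fix f :: "real \<Rightarrow> real"
  assume f: "\<And>x. isCont f x" "\<And>x. \<bar>f x\<bar> \<le> 1"
  have [measurable]: "f \<in> borel_measurable borel"
    by (intro borel_measurable_continuous_onI continuous_at_imp_continuous_on ballI f)
  have "(\<lambda>n. \<integral>\<omega>. f (X n \<omega>) \<partial>M) \<longlonglongrightarrow> (\<integral>\<omega>. f (Y \<omega>) \<partial>M)"
  proof (rule integral_dominated_convergence[where w = "\<lambda>_. 1"])
    show "AE \<omega> in M. (\<lambda>n. f (X n \<omega>)) \<longlonglongrightarrow> f (Y \<omega>)"
      using lim by eventually_elim (rule isCont_tendsto_compose[OF f(1)])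
  qed (use f in auto)
  then show "(\<lambda>n. integral\<^sup>L (distr M borel (X n)) f) \<longlonglongrightarrow> integral\<^sup>L (distr M borel Y) f"
    by (simp add: integral_distr)
qed auto

section \<open>Quenched survival probability, quenched mean and the law of the ratio\<close>

context pf_gw_process
begin

abbreviation "envA \<omega> \<equiv> \<lambda>k. A k \<omega>"
abbreviation "envB \<omega> \<equiv> \<lambda>k. B k \<omega>"

lemma env_measurable [measurable]:
  assumes "1 \<le> k" shows "A k \<in> borel_measurable M" "B k \<in> borel_measurable M"
proof -
  have "(\<lambda>\<omega>. (A k \<omega>, B k \<omega>)) \<in> borel_measurable M"
    using env_indep assms by (auto simp: indep_vars_def2)
  then have *: "(\<lambda>\<omega>. (A k \<omega>, B k \<omega>)) \<in> M \<rightarrow>\<^sub>M borel \<Otimes>\<^sub>M borel"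
    by (simp add: borel_prod)
  show "A k \<in> borel_measurable M" "B k \<in> borel_measurable M"
    using measurable_compose[OF * measurable_fst] measurable_compose[OF * measurable_snd] by simp_all
qed

lemma subalgebra_env: "subalgebra M (env_algebra M A B)"
proof -
  have "(\<lambda>\<omega>. \<lambda>n\<in>{1..}. (A n \<omega>, B n \<omega>)) \<in> M \<rightarrow>\<^sub>M (\<Pi>\<^sub>M n\<in>{1::nat..}. borel)"
    using env_indep by (intro measurable_restrict) (auto simp: indep_vars_def2)
  then show ?thesis
    unfolding subalgebra_def env_algebra_def by (intro conjI sets_image_in_sets) simp_all
qed

sublocale env: sigma_finite_subalgebra M "env_algebra M A B"
  by (intro finite_measure_subalgebra_is_sigma_finite)
    (simp add: finite_measure_subalgebra_def finite_measure_subalgebra_axioms_def subalgebra_env finite_measure_axioms)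

lemma AE_env_pos: "AE \<omega> in M. \<forall>k\<ge>1. 0 < A k \<omega> \<and> 0 < B k \<omega> \<and> 1 \<le> A k \<omega> + B k \<omega>"
proof -
  have "AE \<omega> in M. 1 \<le> k \<longrightarrow> 0 < A k \<omega> \<and> 0 < B k \<omega> \<and> 1 \<le> A k \<omega> + B k \<omega>" for k
    using env_range[of k] by (cases "1 \<le> k") auto
  then show ?thesis by (subst AE_all_countable) auto
qed

text \<open>\<open>g (Z n)\<close> is a countable combination of indicators of path events.
  \<open>Z_given_env\<close> evaluates the conditional expectation of each of them, and the
  countably many exceptional null sets are collected into one.\<close>

lemma nn_cond_exp_Z:
  fixes g :: "nat \<Rightarrow> ennreal"
  shows "AE \<omega> in M. nn_cond_exp M (env_algebra M A B) (\<lambda>\<omega>. g (Z n \<omega>)) \<omega>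
    = (\<integral>\<^sup>+k. g k \<partial>measure_pmf (map_pmf last (quenched_law \<theta> (envA \<omega>) (envB \<omega>) n)))"
proof -
  let ?F = "env_algebra M A B"
  let ?path = "\<lambda>\<omega>. map (\<lambda>k. Z k \<omega>) [0..<Suc n]"
  \<comment> \<open>\<open>list_decode\<close> is a bijection from the naturals to the lists of
    naturals, so it enumerates all candidate paths; the events for lists of the wrong length are
    empty.\<close>
  define E where "E m = {\<omega> \<in> space M. ?path \<omega> = list_decode m}" for m
  have [measurable]: "Z k \<in> M \<rightarrow>\<^sub>M count_space UNIV" for k by (rule Z_measurable)
  have E_sets [measurable]: "E m \<in> sets M" for m
  proof -
    have "E m = {\<omega> \<in> space M. Suc n = length (list_decode m) \<and> (\<forall>k<Suc n. Z k \<omega> = list_decode m ! k)}"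
      by (auto simp: E_def list_eq_iff_nth_eq simp del: upt_Suc)
    also have "\<dots> \<in> sets M" by measurable
    finally show ?thesis .
  qed
  let ?c = "\<lambda>m. g (last (list_decode m))"
  have "AE \<omega> in M. nn_cond_exp M ?F (\<lambda>\<omega>. g (Z n \<omega>)) \<omega>
      = nn_cond_exp M ?F (\<lambda>\<omega>. \<Sum>m. ?c m * indicator (E m) \<omega>) \<omega>"
  proof (rule env.nn_cond_exp_cong)
    have "g (Z n \<omega>) = (\<Sum>m. ?c m * indicator (E m) \<omega>)" if "\<omega> \<in> space M" for \<omega>
    proof -
      have "indicator (E m) \<omega> = (if m = list_encode (?path \<omega>) then 1 else 0 :: ennreal)" for m
      proof -
        have "m = list_encode (?path \<omega>) \<longleftrightarrow> ?path \<omega> = list_decode m"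
          by (metis list_encode_inverse list_decode_inverse)
        then show ?thesis using that by (simp add: E_def indicator_def del: upt_Suc)
      qed
      then have "(\<Sum>m. ?c m * indicator (E m) \<omega>) = (\<Sum>m. if m = list_encode (?path \<omega>) then ?c m else 0)"
        by (intro suminf_cong) simp
      also have "\<dots> = ?c (list_encode (?path \<omega>))"
        using sums_single[of "list_encode (?path \<omega>)" ?c] by (simp add: sums_iff del: upt_Suc)
      finally show ?thesis by simp
    qed
    then show "AE \<omega> in M. g (Z n \<omega>) = (\<Sum>m. ?c m * indicator (E m) \<omega>)" by (intro AE_I2)
  qed auto
  moreover have "AE \<omega> in M. (\<Sum>m. nn_cond_exp M ?F (\<lambda>\<omega>. ?c m * indicator (E m) \<omega>) \<omega>)
      = nn_cond_exp M ?F (\<lambda>\<omega>. \<Sum>m. ?c m * indicator (E m) \<omega>) \<omega>"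
    by (rule env.nn_cond_exp_suminf) auto
  moreover have "AE \<omega> in M. \<forall>m. ?c m * nn_cond_exp M ?F (indicator (E m)) \<omega>
      = nn_cond_exp M ?F (\<lambda>\<omega>. ?c m * indicator (E m) \<omega>) \<omega>"
    by (subst AE_all_countable) (intro allI env.nn_cond_exp_prod, auto)
  moreover have "AE \<omega> in M. \<forall>m. ennreal (real_cond_exp M ?F (indicator (E m)) \<omega>)
      = nn_cond_exp M ?F (indicator (E m)) \<omega>"
    by (subst AE_all_countable) (intro allI env.real_cond_exp_indicator_eq_nn_cond_exp, auto)
  moreover have "AE \<omega> in M. \<forall>m. real_cond_exp M ?F (indicator (E m)) \<omega>
      = pmf (quenched_law \<theta> (envA \<omega>) (envB \<omega>) n) (list_decode m)"
    unfolding E_def by (subst AE_all_countable) (intro allI Z_given_env)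
  ultimately show ?thesis
  proof eventually_elim
    case (elim \<omega>)
    let ?p = "quenched_law \<theta> (envA \<omega>) (envB \<omega>) n"
    have "nn_cond_exp M ?F (\<lambda>\<omega>. g (Z n \<omega>)) \<omega> = (\<Sum>m. ?c m * ennreal (pmf ?p (list_decode m)))"
      by (simp only: elim(1) elim(2)[symmetric] elim(3)[rule_format, symmetric]
          elim(4)[rule_format, symmetric] elim(5)[rule_format])
    also have "\<dots> = (\<integral>\<^sup>+m. ennreal (pmf ?p (list_decode m)) * ?c m \<partial>count_space UNIV)"
      by (simp add: nn_integral_count_space_nat mult.commute)
    also have "\<dots> = (\<integral>\<^sup>+zs. ennreal (pmf ?p zs) * g (last zs) \<partial>count_space UNIV)"
      by (rule nn_integral_bij_count_space[OF bij_list_decode])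
    also have "\<dots> = (\<integral>\<^sup>+k. g k \<partial>measure_pmf (map_pmf last ?p))"
      unfolding nn_integral_map_pmf by (rule nn_integral_measure_pmf[symmetric])
    finally show ?case .
  qed
qed

lemma AE_quenched_PF_gf:
  "AE \<omega> in M. \<forall>n. has_PF_gf \<theta> (env_Pi (envA \<omega>) n) (env_R (envA \<omega>) (envB \<omega>) n)
    (map_pmf last (quenched_law \<theta> (envA \<omega>) (envB \<omega>) n))"
  using AE_env_pos by eventually_elim (auto intro!: quenched_law_PF_gf theta)

lemma AE_quenched_prob:
  "AE \<omega> in M. \<forall>n. quenched_prob M (env_algebra M A B) (\<lambda>\<omega>. Z n \<omega> > 0) \<omega>
    = (env_Pi (envA \<omega>) n + env_R (envA \<omega>) (envB \<omega>) n) powr (- 1 / \<theta>)"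
  unfolding AE_all_countable
proof
  fix n
  let ?F = "env_algebra M A B" and ?E = "{\<omega> \<in> space M. Z n \<omega> > 0}"
  have [measurable]: "Z n \<in> M \<rightarrow>\<^sub>M count_space UNIV" by (rule Z_measurable)
  have "AE \<omega> in M. nn_cond_exp M ?F (\<lambda>\<omega>. indicator {0<..} (Z n \<omega>)) \<omega> = nn_cond_exp M ?F (indicator ?E) \<omega>"
    by (rule env.nn_cond_exp_cong) (auto simp: indicator_def intro!: AE_I2)
  moreover have "AE \<omega> in M. ennreal (real_cond_exp M ?F (indicator ?E) \<omega>) = nn_cond_exp M ?F (indicator ?E) \<omega>"
    by (rule env.real_cond_exp_indicator_eq_nn_cond_exp) measurable
  \<comment> \<open>\<open>ennreal\<close> sends negative reals to 0, so nonnegativity must be known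
    before it can be cancelled from the identity below.\<close>
  moreover have "AE \<omega> in M. 0 \<le> real_cond_exp M ?F (indicator ?E) \<omega>"
    by (rule env.real_cond_exp_pos) (auto simp: indicator_def)
  ultimately show "AE \<omega> in M. quenched_prob M ?F (\<lambda>\<omega>. Z n \<omega> > 0) \<omega>
      = (env_Pi (envA \<omega>) n + env_R (envA \<omega>) (envB \<omega>) n) powr (- 1 / \<theta>)"
    using nn_cond_exp_Z[of "indicator {0<..}" n] AE_quenched_PF_gf
  proof eventually_elim
    case (elim \<omega>)
    let ?p = "map_pmf last (quenched_law \<theta> (envA \<omega>) (envB \<omega>) n)"
    have "ennreal (real_cond_exp M ?F (indicator ?E) \<omega>) = emeasure (measure_pmf ?p) {0<..}"
      using elim by (simp del: nn_integral_map_pmf)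
    also have "\<dots> = ennreal ((env_Pi (envA \<omega>) n + env_R (envA \<omega>) (envB \<omega>) n) powr (- 1 / \<theta>))"
      using prob_positive_PF_gf[of \<theta> _ _ ?p] elim(5)
      by (simp add: measure_pmf.emeasure_eq_measure del: measure_map_pmf)
    finally show ?case using elim(3) by (simp add: quenched_prob_def)
  qed
qed

text \<open>\<open>Z n\<close> vanishes off the survival event, so the indicator changes nothing and
  the unconditional mean from \<open>mean_PF_gf\<close> appears.\<close>

lemma AE_quenched_mean:
  "AE \<omega> in M. \<forall>n. nn_cond_exp M (env_algebra M A B)
      (\<lambda>\<omega>. ennreal (real (Z n \<omega>)) * indicator {\<omega> \<in> space M. Z n \<omega> > 0} \<omega>) \<omega>
    = ennreal (env_Pi (envA \<omega>) n powr (- 1 / \<theta>))"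
  unfolding AE_all_countable
proof
  fix n
  let ?F = "env_algebra M A B"
  have [measurable]: "Z n \<in> M \<rightarrow>\<^sub>M count_space UNIV" by (rule Z_measurable)
  have "AE \<omega> in M. nn_cond_exp M ?F (\<lambda>\<omega>. of_nat (Z n \<omega>)) \<omega>
      = nn_cond_exp M ?F (\<lambda>\<omega>. ennreal (real (Z n \<omega>)) * indicator {\<omega> \<in> space M. Z n \<omega> > 0} \<omega>) \<omega>"
    by (rule env.nn_cond_exp_cong) (auto simp: indicator_def ennreal_of_nat_eq_real_of_nat intro!: AE_I2)
  then show "AE \<omega> in M. nn_cond_exp M ?F
      (\<lambda>\<omega>. ennreal (real (Z n \<omega>)) * indicator {\<omega> \<in> space M. Z n \<omega> > 0} \<omega>) \<omega>
      = ennreal (env_Pi (envA \<omega>) n powr (- 1 / \<theta>))"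
    using nn_cond_exp_Z[of of_nat n] AE_quenched_PF_gf AE_env_pos
  proof eventually_elim
    case (elim \<omega>)
    have "(\<integral>\<^sup>+k. of_nat k \<partial>measure_pmf (map_pmf last (quenched_law \<theta> (envA \<omega>) (envB \<omega>) n)))
        = ennreal (env_Pi (envA \<omega>) n powr (- 1 / \<theta>))"
      using elim theta by (intro mean_PF_gf[of \<theta> _ "env_R (envA \<omega>) (envB \<omega>) n"] env_Pi_pos env_R_nonneg) auto
    with elim show ?case by (simp del: nn_integral_map_pmf)
  qed
qed

text \<open>By \<open>env_R_div_Pi\<close> the ratio is almost surely a function \<open>G\<close> of
  the reversed vector of the first n environments, and an iid vector has the same law in either
  order. The equality is one of laws for each fixed n, hence yields limits in distribution
  only.\<close>

lemma distr_env_ratio: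
  "distr M borel (\<lambda>\<omega>. env_R (envA \<omega>) (envB \<omega>) n / env_Pi (envA \<omega>) n)
    = distr M borel (\<lambda>\<omega>. env_S (envA \<omega>) (envB \<omega>) n)"
\<comment> \<open>The product description of independence is applied to a nonempty index set; for n
  = 0 both variables are 0.\<close>
proof (cases "n = 0")
  case True
  then show ?thesis by (simp add: env_R_def env_S_def)
next
  case False
  let ?I = "{1..n}"
  let ?X = "\<lambda>k \<omega>. (A k \<omega>, B k \<omega>)"
  let ?J = "\<lambda>\<omega>. \<lambda>k\<in>?I. ?X k \<omega>"
  let ?rev = "\<lambda>x. \<lambda>k\<in>?I. x (n + 1 - k)"
  let ?P = "\<Pi>\<^sub>M k\<in>?I. (borel :: (real \<times> real) measure)"
  define D where "D = distr M borel (?X 1)"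
  define G where "G x = env_S (\<lambda>k. fst (x k)) (\<lambda>k. snd (x k)) n" for x :: "nat \<Rightarrow> real \<times> real"
  have rv: "?X k \<in> borel_measurable M" if "k \<in> ?I" for k
    using env_indep that by (auto simp: indep_vars_def2)
  have D: "prob_space D" unfolding D_def by (rule prob_space_distr) (use False in \<open>auto intro!: rv\<close>)
  have joint: "distr M ?P ?J = (\<Pi>\<^sub>M k\<in>?I. D)"
  proof -
    have "indep_vars (\<lambda>_. borel) ?X ?I" by (rule indep_vars_subset[OF env_indep]) auto
    then have "distr M ?P ?J = (\<Pi>\<^sub>M k\<in>?I. distr M borel (?X k))"
      by (rule indep_vars_iff_distr_eq_PiM'[THEN iffD1, rotated 2]) (use False rv in auto)
    also have "\<dots> = (\<Pi>\<^sub>M k\<in>?I. D)"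
      unfolding D_def by (intro PiM_cong refl env_ident) simp
    finally show ?thesis .
  qed
  have sets_D: "sets (\<Pi>\<^sub>M k\<in>?I. D) = sets ?P" by (intro sets_PiM_cong) (auto simp: D_def)
  have J [measurable]: "?J \<in> M \<rightarrow>\<^sub>M ?P" by (intro measurable_restrict rv)
  have rev_meas [measurable]: "?rev \<in> ?P \<rightarrow>\<^sub>M ?P"
    by (intro measurable_restrict measurable_component_singleton) auto
  have fst_meas: "(\<lambda>x. fst (x k)) \<in> borel_measurable ?P" "(\<lambda>x. snd (x k)) \<in> borel_measurable ?P"
    if "k \<in> ?I" for k
  proof -
    have *: "(\<lambda>x. x k) \<in> ?P \<rightarrow>\<^sub>M borel \<Otimes>\<^sub>M borel"
      using measurable_component_singleton[OF that, of "\<lambda>_. borel :: (real \<times> real) measure"]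
      by (simp add: borel_prod)
    show "(\<lambda>x. fst (x k)) \<in> borel_measurable ?P" "(\<lambda>x. snd (x k)) \<in> borel_measurable ?P"
      using measurable_compose[OF * measurable_fst] measurable_compose[OF * measurable_snd] by simp_all
  qed
  have G [measurable]: "G \<in> borel_measurable ?P"
    unfolding G_def env_S_def env_Pi_def
    by (intro borel_measurable_sum borel_measurable_divide borel_measurable_prod fst_meas) auto
  have "distr M borel (\<lambda>\<omega>. env_S (envA \<omega>) (envB \<omega>) n) = distr M borel (G \<circ> ?J)"
    by (intro distr_cong refl) (auto simp: G_def intro!: env_S_cong)
  also have "\<dots> = distr (\<Pi>\<^sub>M k\<in>?I. D) borel G"
    unfolding joint[symmetric] by (rule distr_distr[OF G J, symmetric])
  \<comment> \<open>Equal factors make the product measure invariant under the permutation sending k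
    to n + 1 - k.\<close>
  also have "(\<Pi>\<^sub>M k\<in>?I. D) = distr (\<Pi>\<^sub>M k\<in>?I. D) (\<Pi>\<^sub>M k\<in>?I. D) ?rev"
    by (rule distr_PiM_reindex[symmetric]) (auto simp: D inj_on_def)
  also have "\<dots> = distr (\<Pi>\<^sub>M k\<in>?I. D) ?P ?rev"
    by (rule distr_cong[OF refl sets_D refl])
  also have "distr \<dots> borel G = distr M borel (G \<circ> ?rev \<circ> ?J)"
    unfolding joint[symmetric] distr_distr[OF rev_meas J] distr_distr[OF G measurable_comp[OF J rev_meas]]
    by (simp only: comp_assoc)
  also have "\<dots> = distr M borel (\<lambda>\<omega>. env_R (envA \<omega>) (envB \<omega>) n / env_Pi (envA \<omega>) n)"
  proof (rule distr_cong_AE[OF refl refl])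
    show "AE \<omega> in M. (G \<circ> ?rev \<circ> ?J) \<omega> = env_R (envA \<omega>) (envB \<omega>) n / env_Pi (envA \<omega>) n"
      using AE_env_pos
    proof eventually_elim
      case (elim \<omega>)
      then have "env_R (envA \<omega>) (envB \<omega>) n / env_Pi (envA \<omega>) n
          = env_S (\<lambda>k. envA \<omega> (n + 1 - k)) (\<lambda>k. envB \<omega> (n + 1 - k)) n"
        by (intro env_R_div_Pi) (metis less_irrefl)
      then show ?case by (auto simp: G_def intro!: env_S_cong)
    qed
    show "(\<lambda>\<omega>. env_R (envA \<omega>) (envB \<omega>) n / env_Pi (envA \<omega>) n) \<in> borel_measurable M"
      unfolding env_R_def env_Pi_def
      by (intro borel_measurable_sum borel_measurable_divide borel_measurable_prod
          borel_measurable_times env_measurable) auto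
  qed (use measurable_comp[OF J measurable_comp[OF rev_meas G]] in \<open>simp add: comp_assoc\<close>)
  finally show ?thesis by simp
qed

end

section \<open>Pathwise limits in the reversed environment and limits in distribution\<close>

lemma
  assumes ab: "\<And>k. 1 \<le> k \<Longrightarrow> 0 < a k \<and> 0 < b k" and fin: "env_Rinv_inf a b < \<infinity>"
  shows env_S_tendsto: "env_S a b \<longlonglongrightarrow> enn2real (env_Rinv_inf a b)"
    and env_Rinv_inf_pos: "0 < enn2real (env_Rinv_inf a b)"
proof -
  let ?f = "\<lambda>k. b (Suc k) / env_Pi a (Suc k)"
  have f: "0 < ?f k" for k using ab by (auto intro!: divide_pos_pos env_Pi_pos)
  have summ: "summable ?f"
    using fin f by (intro summable_suminf_not_top) (auto simp: env_Rinv_inf_def less_imp_le)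
  have eq: "enn2real (env_Rinv_inf a b) = suminf ?f"
    unfolding env_Rinv_inf_def
    using suminf_ennreal2[OF less_imp_le[OF f] summ] suminf_nonneg[OF summ less_imp_le[OF f]] by simp
  have "env_S a b n = sum ?f {..<n}" for n
    unfolding env_S_def by (simp add: sum.atLeast1_atMost_eq)
  then have "env_S a b = (\<lambda>n. sum ?f {..<n})" by auto
  then show "env_S a b \<longlonglongrightarrow> enn2real (env_Rinv_inf a b)"
    unfolding eq using summable_LIMSEQ[OF summ] by simp
  \<comment> \<open>Strict positivity keeps \<open>1 / (1 + r)\<close> below 1, so that both
    parameters of the limiting \<open>PF_plus\<close> law are positive.\<close>
  show "0 < enn2real (env_Rinv_inf a b)"
    unfolding eq using summ f by (intro suminf_pos) auto
qed

text \<open>Applying \<open>env_R_div_Pi\<close> to the reversed environment reverses it a second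
  time, so the ratio d / c is the partial sum in the original order. Conditioning on survival leaves
  only this ratio.\<close>

lemma cond_reversed_PF_gf:
  assumes \<theta>: "0 < \<theta>" "\<theta> \<le> 1" and ab: "\<And>k. 1 \<le> k \<Longrightarrow> 0 < a k \<and> 0 < b k \<and> 1 \<le> a k + b k"
  shows "has_PF_gf \<theta> (1 / (1 + env_S a b n)) (env_S a b n / (1 + env_S a b n))
    (cond_pmf (map_pmf (\<lambda>zs. zs ! n) (reversed_quenched_law \<theta> a b n)) {0<..})"
proof -
  let ?a = "\<lambda>k. a (n + 1 - k)" and ?b = "\<lambda>k. b (n + 1 - k)"
  define c d where "c = env_Pi ?a n" and "d = env_R ?a ?b n"
  have ab': "0 < ?a k \<and> 0 < ?b k \<and> 1 \<le> ?a k + ?b k" if "1 \<le> k" "k \<le> n" for k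
    using ab[of "n + 1 - k"] that by auto
  have c: "0 < c" unfolding c_def using ab' by (intro env_Pi_pos) auto
  have d: "0 \<le> d" unfolding d_def using ab' by (intro env_R_nonneg) auto
  have "d / c = env_S (\<lambda>k. ?a (n + 1 - k)) (\<lambda>k. ?b (n + 1 - k)) n"
    unfolding c_def d_def by (intro env_R_div_Pi) (metis ab' less_irrefl)
  \<comment> \<open>Truncated subtraction gives back k only for k up to n + 1;
    \<open>env_S_cong\<close> compares just the indices from 1 to n.\<close>
  also have "\<dots> = env_S a b n" by (intro env_S_cong) auto
  finally have S: "env_S a b n = d / c" by simp
  have "has_PF_gf \<theta> c d (map_pmf last (quenched_law \<theta> ?a ?b n))"
    unfolding c_def d_def by (intro quenched_law_PF_gf \<theta> ab')
  from cond_pmf_PF_gf[OF this c d]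
  have "has_PF_gf \<theta> (c / (c + d)) (d / (c + d)) (cond_pmf (map_pmf (\<lambda>zs. zs ! n) (reversed_quenched_law \<theta> a b n)) {0<..})"
    by (simp add: reversed_quenched_law_def quenched_law_def map_nth_gw_path)
  moreover have "c / (c + d) = 1 / (1 + env_S a b n)" "d / (c + d) = env_S a b n / (1 + env_S a b n)"
    unfolding S using c d by (simp_all add: field_simps)
  ultimately show ?thesis by simp
qed

text \<open>The generating functions depend continuously on the partial sum, which converges along
  the given environment. Their limit passes to the mass functions and from there to total
  variation.\<close>

lemma tendsto_tv_dist_cond_reversed:
  assumes \<theta>: "0 < \<theta>" "\<theta> \<le> 1" and ab: "\<And>k. 1 \<le> k \<Longrightarrow> 0 < a k \<and> 0 < b k \<and> 1 \<le> a k + b k"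
    and fin: "env_Rinv_inf a b < \<infinity>"
  shows "(\<lambda>n. tv_dist (cond_pmf (map_pmf (\<lambda>zs. zs ! n) (reversed_quenched_law \<theta> a b n)) {0<..})
    (PF_plus \<theta> (1 / (1 + enn2real (env_Rinv_inf a b))))) \<longlonglongrightarrow> 0"
proof (intro tendsto_tv_dist_if_tendsto_pmf tendsto_pmf_if_tendsto_pgf)
  fix s :: real assume s: "0 < s" "s < 1"
  define r where "r = enn2real (env_Rinv_inf a b)"
  have lim: "env_S a b \<longlonglongrightarrow> r" and r: "0 < r"
    unfolding r_def using env_S_tendsto env_Rinv_inf_pos ab fin by blast+
  have r': "1 - 1 / (1 + r) = r / (1 + r)" using r by (simp add: field_simps)
  have q: "pgf (PF_plus \<theta> (1 / (1 + r))) s = 1 - (1 / (1 + r) / (1 - s) powr \<theta> + r / (1 + r)) powr (- 1 / \<theta>)"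
    unfolding PF_plus_def r' using r s \<theta>
    by (intro pgf_PF) (auto simp flip: add_divide_distrib)
  have "0 < 1 / (1 + r) / (1 - s) powr \<theta> + r / (1 + r)"
    using r s by (intro add_pos_pos divide_pos_pos) auto
  then have "(\<lambda>n. 1 - (1 / (1 + env_S a b n) / (1 - s) powr \<theta> + env_S a b n / (1 + env_S a b n)) powr (- 1 / \<theta>))
      \<longlonglongrightarrow> 1 - (1 / (1 + r) / (1 - s) powr \<theta> + r / (1 + r)) powr (- 1 / \<theta>)"
    using r s by (intro tendsto_intros lim) auto
  then show "(\<lambda>n. pgf (cond_pmf (map_pmf (\<lambda>zs. zs ! n) (reversed_quenched_law \<theta> a b n)) {0<..}) s)
      \<longlonglongrightarrow> pgf (PF_plus \<theta> (1 / (1 + enn2real (env_Rinv_inf a b)))) s"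
    using cond_reversed_PF_gf[of \<theta> a b, OF \<theta> ab] s by (simp add: has_PF_gf_def q flip: r_def)
qed

text \<open>Only the law of each \<open>Y n\<close> matters, so the ratio may be replaced by
  \<open>env_S\<close>, which converges almost surely; continuous mapping finishes. Continuity is
  asked at nonnegative points because the limit lies there, which keeps the powers of 1 + x away
  from x = -1.\<close>

lemma (in pf_gw_process) weak_conv_m_env_ratio:
  assumes fin: "AE \<omega> in M. env_Rinv_inf (envA \<omega>) (envB \<omega>) < \<infinity>"
    and h [measurable]: "h \<in> borel_measurable borel" and cont: "\<And>x. 0 \<le> x \<Longrightarrow> isCont h x"
    and Y [measurable]: "\<And>n. Y n \<in> borel_measurable M"
    and Y_eq: "AE \<omega> in M. \<forall>n. Y n \<omega> = h (env_R (envA \<omega>) (envB \<omega>) n / env_Pi (envA \<omega>) n)"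
  shows "weak_conv_m (\<lambda>n. distr M borel (Y n))
    (distr M borel (\<lambda>\<omega>. h (enn2real (env_Rinv_inf (envA \<omega>) (envB \<omega>)))))"
proof -
  have Pi [measurable]: "(\<lambda>\<omega>. env_Pi (envA \<omega>) n) \<in> borel_measurable M" for n
    unfolding env_Pi_def by (intro borel_measurable_prod env_measurable) auto
  have R [measurable]: "(\<lambda>\<omega>. env_R (envA \<omega>) (envB \<omega>) n) \<in> borel_measurable M" for n
    unfolding env_R_def by (intro borel_measurable_sum borel_measurable_times Pi env_measurable) auto
  have S [measurable]: "(\<lambda>\<omega>. env_S (envA \<omega>) (envB \<omega>) n) \<in> borel_measurable M" for n
    unfolding env_S_def by (intro borel_measurable_sum borel_measurable_divide Pi env_measurable) auto
  have [measurable]: "B (Suc k) \<in> borel_measurable M" for k by (rule env_measurable) simp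
  have [measurable]: "(\<lambda>\<omega>. env_Rinv_inf (envA \<omega>) (envB \<omega>)) \<in> borel_measurable M"
    unfolding env_Rinv_inf_def by measurable
  have "distr M borel (Y n) = distr M borel (\<lambda>\<omega>. h (env_S (envA \<omega>) (envB \<omega>) n))" for n
  proof -
    have "distr M borel (Y n) = distr M borel (\<lambda>\<omega>. h (env_R (envA \<omega>) (envB \<omega>) n / env_Pi (envA \<omega>) n))"
      by (rule distr_cong_AE) (use Y_eq in auto)
    also have "\<dots> = distr (distr M borel (\<lambda>\<omega>. env_R (envA \<omega>) (envB \<omega>) n / env_Pi (envA \<omega>) n)) borel h"
      by (subst distr_distr) (auto simp: comp_def)
    also have "\<dots> = distr M borel (\<lambda>\<omega>. h (env_S (envA \<omega>) (envB \<omega>) n))"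
      unfolding distr_env_ratio by (subst distr_distr) (auto simp: comp_def)
    finally show ?thesis .
  qed
  moreover have "weak_conv_m (\<lambda>n. distr M borel (\<lambda>\<omega>. h (env_S (envA \<omega>) (envB \<omega>) n)))
      (distr M borel (\<lambda>\<omega>. h (enn2real (env_Rinv_inf (envA \<omega>) (envB \<omega>)))))"
  proof (rule weak_conv_m_if_AE_tendsto)
    show "AE \<omega> in M. (\<lambda>n. h (env_S (envA \<omega>) (envB \<omega>) n))
        \<longlonglongrightarrow> h (enn2real (env_Rinv_inf (envA \<omega>) (envB \<omega>)))"
      using fin AE_env_pos
    proof eventually_elim
      case (elim \<omega>)
      then show ?case by (intro isCont_tendsto_compose[OF cont] env_S_tendsto) auto
    qed
  qed measurable
  ultimately show ?thesis by simp
qed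

section \<open>From the parameters of the quenched law to the two identities and their
  limits\<close>

lemma powr_mult_ratio:
  fixes P R t :: real
  assumes "0 < P" "0 \<le> R"
  shows "P powr t * (P + R) powr (- t) = 1 / (1 + R / P) powr t"
    and "P powr (- t) / (P + R) powr (- t) = (1 + R / P) powr t"
proof -
  have "P + R = P * (1 + R / P)" using assms by (simp add: field_simps)
  moreover have "0 \<le> R / P" using assms by simp
  ultimately have *: "(P + R) powr t = P powr t * (1 + R / P) powr t"
    using assms by (simp add: powr_mult)
  then show "P powr t * (P + R) powr (- t) = 1 / (1 + R / P) powr t"
    and "P powr (- t) / (P + R) powr (- t) = (1 + R / P) powr t"
    using assms unfolding powr_minus * by (auto simp: field_simps)
qed

theorem theorem6p2:
  fixes M :: "'w measure" and \<theta> :: real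
    and A B :: "nat \<Rightarrow> 'w \<Rightarrow> real" and Z :: "nat \<Rightarrow> 'w \<Rightarrow> nat"
  defines "F \<equiv> env_algebra M A B"
    and "Pi\<^sub>n \<equiv> \<lambda>n \<omega>. env_Pi (\<lambda>k. A k \<omega>) n"
    and "R\<^sub>n \<equiv> \<lambda>n \<omega>. env_R (\<lambda>k. A k \<omega>) (\<lambda>k. B k \<omega>) n"
    and "Rinv \<equiv> \<lambda>\<omega>. enn2real (env_Rinv_inf (\<lambda>k. A k \<omega>) (\<lambda>k. B k \<omega>))"
  assumes process: "pf_gw_process M \<theta> A B Z"
    and subcritical: "AE \<omega> in M. env_Rinv_inf (\<lambda>k. A k \<omega>) (\<lambda>k. B k \<omega>) < \<infinity>
                               \<and> env_R_inf (\<lambda>k. A k \<omega>) (\<lambda>k. B k \<omega>) = \<infinity>"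
  shows "(AE \<omega> in M. \<forall>n. Pi\<^sub>n n \<omega> powr (1 / \<theta>) * quenched_prob M F (\<lambda>\<omega>. Z n \<omega> > 0) \<omega>
            = 1 / (1 + R\<^sub>n n \<omega> / Pi\<^sub>n n \<omega>) powr (1 / \<theta>))
       \<and> weak_conv_m
            (\<lambda>n. distr M borel
               (\<lambda>\<omega>. Pi\<^sub>n n \<omega> powr (1 / \<theta>) * quenched_prob M F (\<lambda>\<omega>. Z n \<omega> > 0) \<omega>))
            (distr M borel (\<lambda>\<omega>. 1 / (1 + Rinv \<omega>) powr (1 / \<theta>)))
       \<and> (AE \<omega> in M. \<forall>n.
            quenched_expectation_given M F (\<lambda>\<omega>. real (Z n \<omega>)) (\<lambda>\<omega>. Z n \<omega> > 0) \<omega>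
            = (1 + R\<^sub>n n \<omega> / Pi\<^sub>n n \<omega>) powr (1 / \<theta>))
       \<and> weak_conv_m
            (\<lambda>n. distr M borel
               (quenched_expectation_given M F (\<lambda>\<omega>. real (Z n \<omega>)) (\<lambda>\<omega>. Z n \<omega> > 0)))
            (distr M borel (\<lambda>\<omega>. (1 + Rinv \<omega>) powr (1 / \<theta>)))
       \<and> (AE \<omega> in M.
            (\<lambda>n. tv_dist
               (cond_pmf
                  (map_pmf (\<lambda>zs. zs ! n)
                     (reversed_quenched_law \<theta> (\<lambda>k. A k \<omega>) (\<lambda>k. B k \<omega>) n))
                  {0<..})
               (PF_plus \<theta> (1 / (1 + Rinv \<omega>)))) \<longlonglongrightarrow> 0)"
proof -
  interpret pf_gw_process M \<theta> A B Z by (rule process)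
  have fin: "AE \<omega> in M. env_Rinv_inf (envA \<omega>) (envB \<omega>) < \<infinity>"
    using subcritical by eventually_elim simp
  have pos: "AE \<omega> in M. \<forall>n. 0 < Pi\<^sub>n n \<omega> \<and> 0 \<le> R\<^sub>n n \<omega>"
    using AE_env_pos unfolding Pi\<^sub>n_def R\<^sub>n_def
    by eventually_elim (auto intro!: env_Pi_pos env_R_nonneg)
  have prob_eq: "AE \<omega> in M. \<forall>n. Pi\<^sub>n n \<omega> powr (1 / \<theta>) * quenched_prob M F (\<lambda>\<omega>. Z n \<omega> > 0) \<omega>
      = 1 / (1 + R\<^sub>n n \<omega> / Pi\<^sub>n n \<omega>) powr (1 / \<theta>)"
    using AE_quenched_prob pos unfolding Pi\<^sub>n_def R\<^sub>n_def F_def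
    by eventually_elim (simp add: powr_mult_ratio)
  have mean_eq: "AE \<omega> in M. \<forall>n. quenched_expectation_given M F (\<lambda>\<omega>. real (Z n \<omega>)) (\<lambda>\<omega>. Z n \<omega> > 0) \<omega>
      = (1 + R\<^sub>n n \<omega> / Pi\<^sub>n n \<omega>) powr (1 / \<theta>)"
    \<comment> \<open>The numerator is finite, so \<open>enn2real\<close> returns
      \<open>env_Pi\<close> to the power -1/\<theta>; division by the survival probability is the
      second part of \<open>powr_mult_ratio\<close> with t = 1/\<theta>.\<close>
    using AE_quenched_mean AE_quenched_prob pos unfolding Pi\<^sub>n_def R\<^sub>n_def F_def quenched_expectation_given_def
    by eventually_elim (simp add: powr_mult_ratio)
  have [measurable]: "(\<lambda>\<omega>. Pi\<^sub>n n \<omega>) \<in> borel_measurable M" for n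
    unfolding Pi\<^sub>n_def env_Pi_def by (intro borel_measurable_prod env_measurable) auto
  have prob_meas [measurable]: "quenched_prob M F E \<in> borel_measurable M" for E
    unfolding quenched_prob_def by measurable
  have mean_meas: "quenched_expectation_given M F X E \<in> borel_measurable M" for X E
  proof -
    have "(\<lambda>\<omega>. quenched_expectation_given M F X E \<omega>) \<in> borel_measurable M"
      unfolding quenched_expectation_given_def by measurable
    then show ?thesis .
  qed
  have prob_Y_meas: "(\<lambda>\<omega>. Pi\<^sub>n n \<omega> powr (1 / \<theta>) * quenched_prob M F E \<omega>) \<in> borel_measurable M" for n E
    by measurable
  have prob_conv: "weak_conv_m
      (\<lambda>n. distr M borel (\<lambda>\<omega>. Pi\<^sub>n n \<omega> powr (1 / \<theta>) * quenched_prob M F (\<lambda>\<omega>. Z n \<omega> > 0) \<omega>))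
      (distr M borel (\<lambda>\<omega>. 1 / (1 + Rinv \<omega>) powr (1 / \<theta>)))"
    unfolding Rinv_def
    by (rule weak_conv_m_env_ratio[OF fin, of "\<lambda>x. 1 / (1 + x) powr (1 / \<theta>)"])
      (use prob_eq prob_Y_meas in \<open>auto simp: Pi\<^sub>n_def R\<^sub>n_def intro!: continuous_intros\<close>)
  have mean_conv: "weak_conv_m
      (\<lambda>n. distr M borel (quenched_expectation_given M F (\<lambda>\<omega>. real (Z n \<omega>)) (\<lambda>\<omega>. Z n \<omega> > 0)))
      (distr M borel (\<lambda>\<omega>. (1 + Rinv \<omega>) powr (1 / \<theta>)))"
    unfolding Rinv_def
    by (rule weak_conv_m_env_ratio[OF fin, of "\<lambda>x. (1 + x) powr (1 / \<theta>)"])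
      (use mean_eq mean_meas in \<open>auto simp: Pi\<^sub>n_def R\<^sub>n_def intro!: continuous_intros\<close>)
  have tv: "AE \<omega> in M. (\<lambda>n. tv_dist
      (cond_pmf (map_pmf (\<lambda>zs. zs ! n) (reversed_quenched_law \<theta> (envA \<omega>) (envB \<omega>) n)) {0<..})
      (PF_plus \<theta> (1 / (1 + Rinv \<omega>)))) \<longlonglongrightarrow> 0"
    using fin AE_env_pos unfolding Rinv_def
    by eventually_elim (intro tendsto_tv_dist_cond_reversed theta, auto)
  show ?thesis using prob_eq prob_conv mean_eq mean_conv tv by blast
qed

end
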